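(* Let $a_1\ge a_2$ and $b_1\ge b_2$ be positive integers. Then \[\rho(K_{a_1,a_2},K_{b_1,b_2})=\begin{cases} \frac{b_1b_2}{a_1a_2} & \text{if } b_1\ge a_1,\ b_2\ge a_2,\\[2pt] \frac{b_2}{a_2} & \text{if } b_1\le a_1,\ b_2\ge a_2,\\[2pt] \max\left\{\frac{b_2}{a_2},\frac{b_1+b_2}{a_1+a_2}\right\} & \text{if } b_1\le a_1,\ b_2\le a_2,\\[2pt] \frac{b_1+b_2}{a_1+a_2} & \text{if } b_1\ge a_1,\ b_2\le a_2,\ b_1+b_2\le a_1+a_2,\\[2pt] \frac{b_1}{a_1+a_2-1} & \text{if } b_1\ge a_1,\ b_2=1,\ b_1+b_2\ge a_1+a_2. \end{cases}\]
   Context: $K_{a,b}$ denotes the complete bipartite graph with parts of sizes $a$ and $b$. A graphon is a symmetric measurable function $W:[0,1]^2\to[0,1]$. For a finite simple graph $G$ with vertices $v_1,\dots,v_n$, put $t(G,W)=\int_{[0,1]^n}\prod_{v_iv_j\in E(G)}W(x_i,x_j)\,dx_1\cdots dx_n$; for a finite graph $W$ (loops allowed), $t(G,W)=\hom(G,W)/|V(W)|^{|V(G)|}$, where $\hom(G,W)$ is the number of maps $V(G)\to V(W)$ sending edges to edges. For finite simple graphs $G,H$, the density domination exponent is $\rho(G,H)=\sup_W \frac{\log t(H,W)}{\log t(G,W)}\in[0,\infty]$, where $W$ ranges over all graphons (equivalently, all finite graphs) with $t(G,W)\ne 0$. Conventions: those $W$ with $t(G,W)=1$, where the quotient is undefined,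 are omitted; $\log 0=-\infty$, so the quotient is $+\infty$ if $t(H,W)=0$. Thus, when $G$ has at least one edge, for $c>0$ one has $\rho(G,H)\le c$ if and only if $t(H,W)\ge t(G,W)^c$ for every $W$. *)

theory Defs
  imports "HOL-Analysis.Analysis"
begin

record sgraph =
  verts :: "nat set"
  edges :: "nat set set"

definition simple_graph :: "sgraph \<Rightarrow> bool" where
  "simple_graph G \<longleftrightarrow> finite (verts G) \<and> edges G \<subseteq> {e. e \<subseteq> verts G \<and> card e = 2}"

definition complete_bipartite :: "nat \<Rightarrow> nat \<Rightarrow> sgraph" where
  "complete_bipartite a b =
     \<lparr>verts = {..<a + b}, edges = {{u, v} | u v. u \<in> {..<a} \<and> v \<in> {a..<a + b}}\<rparr>"

lemma simple_graph_complete_bipartite: "simple_graph (complete_bipartite a b)"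
  by (fastforce simp: simple_graph_def complete_bipartite_def card_2_iff)

text \<open>Measurability is in the sense of Lebesgue. Only the values of a graphon on the unit square
  are constrained.\<close>

definition graphon :: "(real \<Rightarrow> real \<Rightarrow> real) \<Rightarrow> bool" where
  "graphon W \<longleftrightarrow>
     (\<lambda>(x, y). W x y) \<in> borel_measurable (lebesgue_on ({0..1} \<times> {0..1})) \<and>
     (\<forall>x\<in>{0..1}. \<forall>y\<in>{0..1}. W x y = W y x \<and> 0 \<le> W x y \<and> W x y \<le> 1)"

text \<open>The completed product is Lebesgue measure on the cube; without the completion the integrand
  need not be measurable for a graphon that is not Borel. The condition \<open>u < v\<close> makes every
  edge contribute a single factor, whose orientation is irrelevant as graphons are symmetric.\<close>

definition hom_density :: "sgraph \<Rightarrow> (real \<Rightarrow> real \<Rightarrow> real) \<Rightarrow> real" where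
  "hom_density G W =
     (LINT x | completion (\<Pi>\<^sub>M v\<in>verts G. restrict_space lborel {0..1}).
        (\<Prod>(u, v) \<in> {(u, v). u < v \<and> {u, v} \<in> edges G}. W (x u) (x v)))"

text \<open>For graphons, both densities lie between 0 and 1, so the quotient of logarithms below is
  nonnegative and the embedding into the extended nonnegative reals does not truncate it.\<close>

definition domination_exponent :: "sgraph \<Rightarrow> sgraph \<Rightarrow> ennreal" where
  "domination_exponent G H =
     (SUP W \<in> {W. graphon W \<and> hom_density G W \<noteq> 0 \<and> hom_density G W \<noteq> 1}.
        if hom_density H W = 0 then \<infinity>
        else ennreal (ln (hom_density H W) / ln (hom_density G W)))"

end

theory Submission
  imports Defs "HOL-Probability.Infinite_Product_Measure"
begin

text \<open>Write \<open>f(a,b)\<close> for the density of \<open>K\<^bsub>a,b\<^esub>\<close>, the mean of the \<open>b\<close>-th power of the common degree of \<open>a\<close>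
  random vertices. Three inequalities give the upper bounds. Jensen's inequality bounds \<open>f(a,b)\<close>
  from below by \<open>f(a,b')\<close> raised to the power \<open>b/b'\<close>, for \<open>b' \<le> b\<close>. Deleting edges shows
  \<open>f(a,b) \<le> f(k,a+b-k)\<close> for \<open>k \<le> min a b\<close>. Finner's inequality, applied to the \<open>a\<close> vertices of one
  side only, bounds \<open>f(a,b)\<close> by a product of powers of densities of smaller complete bipartite
  graphs that fractionally pack \<open>K\<^bsub>a,b\<^esub>\<close>. The values in the theorem are attained or approached by a
  constant graphon, one clique, two disjoint cliques, or a small set of vertices joined to
  everything.\<close>

subsection \<open>Finner's inequality\<close>

text \<open>Finner is needed for one side only because the other side is integrated out beforehand,
  which leaves the mean of \<open>deg V x ^ b\<close>. Degrees lie in [0,1] and grow when vertices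
  are dropped from the set, so the capacity b of the integrated side is respected pointwise, by
  comparing exponents. A packing therefore has to meet just two linear conditions, one per side.
  These conditions explain the maximum in the third case. Copies of K_{b1,b2} alone, with weight
  a2/b2, fit exactly when b1*a2 <= b2*a1, and give b2/a2. Otherwise both sides have to be filled, by
  graphs on b1+b2 vertices of total weight (a1+a2)/(b1+b2). The average size of their first sides is
  then forced and need not be an integer, so two neighbouring splits are mixed. A second obstacle is
  measurability: graphons are only Lebesgue measurable and only constrained on the unit square. All
  inequalities are therefore proved for kernels that are measurable without completion and
  constrained everywhere, and a graphon is exchanged for such a kernel off a null set.\<close>

lemma weighted_arith_geo_mean:
  fixes t w :: "'j \<Rightarrow> real"
  assumes "finite J" and t: "\<And>j. j \<in> J \<Longrightarrow> 0 \<le> t j" and w: "\<And>j. j \<in> J \<Longrightarrow> 0 \<le> w j"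
    and le1: "sum w J \<le> 1"
  shows "(\<Prod>j\<in>J. t j powr w j) \<le> (\<Sum>j\<in>J. w j * t j) + (1 - sum w J)"
proof (cases "\<exists>j\<in>J. t j = 0")
  case True
  \<comment> \<open>\<open>0 powr 0\<close> is 0, so a vanishing \<open>t j\<close> kills the
    product even if its weight is zero.\<close>
  then have "(\<Prod>j\<in>J. t j powr w j) = 0"
    using \<open>finite J\<close> by auto
  moreover have "0 \<le> (\<Sum>j\<in>J. w j * t j)"
    by (intro sum_nonneg mult_nonneg_nonneg t w)
  ultimately show ?thesis
    using le1 by simp
next
  case False
  then have pos: "0 < t j" if "j \<in> J" for j
    using t[OF that] that by force
  \<comment> \<open>The arithmetic mean in which the missing weight \<open>1 - sum w J\<close> sits
    on the value 1. Averaging ln s <= s - 1 over s = \<open>t j / A\<close> and s =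
    \<open>1 / A\<close> with these weights gives 0 on the right.\<close>
  define A where "A = (\<Sum>j\<in>J. w j * t j) + (1 - sum w J)"
  have "0 < A"
  proof (cases "sum w J = 1")
    case True
    have "0 < (\<Sum>j\<in>J. w j * t j)"
    proof (rule ccontr)
      assume "\<not> ?thesis"
      then have "(\<Sum>j\<in>J. w j * t j) = 0"
        using sum_nonneg[of J "\<lambda>j. w j * t j"] t w by force
      then have "\<forall>j\<in>J. w j * t j = 0"
        using \<open>finite J\<close> t w by (subst (asm) sum_nonneg_eq_0_iff) auto
      then have "sum w J = 0"
        using pos by (intro sum.neutral) force
      then show False
        using True by simp
    qed
    then show ?thesis
      using True by (simp add: A_def)
  next
    case False
    moreover have "0 \<le> (\<Sum>j\<in>J. w j * t j)"
      by (intro sum_nonneg mult_nonneg_nonneg t w)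
    ultimately show ?thesis
      using le1 by (simp add: A_def)
  qed
  have "(\<Sum>j\<in>J. w j * (ln (t j) - ln A)) \<le> (\<Sum>j\<in>J. w j * (t j / A - 1))"
  proof (intro sum_mono mult_left_mono w)
    fix j assume "j \<in> J"
    then have "ln (t j / A) \<le> t j / A - 1"
      using pos \<open>0 < A\<close> by (intro ln_le_minus_one) auto
    then show "ln (t j) - ln A \<le> t j / A - 1"
      using pos[OF \<open>j \<in> J\<close>] \<open>0 < A\<close> by (simp add: ln_div)
  qed
  moreover have "(1 - sum w J) * (- ln A) \<le> (1 - sum w J) * (1 / A - 1)"
    using ln_le_minus_one[of "1 / A"] \<open>0 < A\<close> le1 by (intro mult_left_mono) (auto simp: ln_div)
  moreover have "(\<Sum>j\<in>J. w j * (ln (t j) - ln A)) = (\<Sum>j\<in>J. w j * ln (t j)) - sum w J * ln A"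
    by (simp add: right_diff_distrib sum_subtractf sum_distrib_right)
  moreover have "(\<Sum>j\<in>J. w j * (t j / A - 1)) + (1 - sum w J) * (1 / A - 1) = 0"
  proof -
    have "(\<Sum>j\<in>J. w j * (t j / A - 1)) + (1 - sum w J) * (1 / A - 1)
        = ((\<Sum>j\<in>J. w j * t j) + (1 - sum w J)) / A - 1"
      by (simp add: right_diff_distrib sum_subtractf add_divide_distrib diff_divide_distrib
          sum_divide_distrib algebra_simps)
    then show ?thesis
      using \<open>0 < A\<close> by (simp add: A_def)
  qed
  ultimately have "(\<Sum>j\<in>J. w j * ln (t j)) \<le> ln A"
    by (simp add: algebra_simps)
  moreover have "(\<Prod>j\<in>J. t j powr w j) = exp (\<Sum>j\<in>J. w j * ln (t j))"
    using pos \<open>finite J\<close> by (simp add: exp_sum powr_def order_less_imp_not_eq2 cong: prod.cong)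
  ultimately show ?thesis
    using \<open>0 < A\<close> by (simp add: A_def ln_ge_iff)
qed

lemma (in prob_space) integrable_unit_bounded:
  fixes f :: "'a \<Rightarrow> real"
  assumes "f \<in> borel_measurable M" "\<And>x. 0 \<le> f x" "\<And>x. f x \<le> 1"
  shows "integrable M f"
  using assms by (intro integrable_const_bound[where B=1]) auto

lemma (in prob_space) integral_unit_bounded:
  fixes f :: "'a \<Rightarrow> real"
  assumes "\<And>x. 0 \<le> f x" "\<And>x. f x \<le> 1"
  shows "0 \<le> (\<integral>x. f x \<partial>M)" "(\<integral>x. f x \<partial>M) \<le> 1"
proof -
  show "0 \<le> (\<integral>x. f x \<partial>M)"
    using assms by simp
  \<comment> \<open>No measurability is assumed: a function that is not integrable has integral 0 by
    convention.\<close>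
  show "(\<integral>x. f x \<partial>M) \<le> 1"
  proof (cases "integrable M f")
    case True
    then have "(\<integral>x. f x \<partial>M) \<le> (\<integral>x. 1 \<partial>M)"
      using assms by (intro integral_mono) auto
    then show ?thesis
      by (simp add: prob_space)
  qed (simp add: not_integrable_integral_eq)
qed

lemma prod_powr_unit_bounded:
  fixes g w :: "'j \<Rightarrow> real"
  assumes "\<And>j. j \<in> J \<Longrightarrow> 0 \<le> g j" "\<And>j. j \<in> J \<Longrightarrow> g j \<le> 1" "\<And>j. j \<in> J \<Longrightarrow> 0 \<le> w j"
  shows "0 \<le> (\<Prod>j\<in>J. g j powr w j)" "(\<Prod>j\<in>J. g j powr w j) \<le> 1"
  using assms by (auto intro!: prod_nonneg prod_le_1 powr_le1)

lemma (in prob_space) Holder_prod: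
  fixes g :: "'j \<Rightarrow> 'a \<Rightarrow> real" and w :: "'j \<Rightarrow> real"
  assumes "finite J" and [measurable]: "\<And>j. j \<in> J \<Longrightarrow> g j \<in> borel_measurable M"
    and g: "\<And>j x. 0 \<le> g j x" "\<And>j x. g j x \<le> 1"
    and w: "\<And>j. j \<in> J \<Longrightarrow> 0 \<le> w j" and le1: "sum w J \<le> 1"
  shows "(\<integral>x. (\<Prod>j\<in>J. g j x powr w j) \<partial>M) \<le> (\<Prod>j\<in>J. (\<integral>x. g j x \<partial>M) powr w j)"
proof (cases "\<exists>j\<in>J. (\<integral>x. g j x \<partial>M) = 0")
  case True
  then obtain i where i: "i \<in> J" "(\<integral>x. g i x \<partial>M) = 0"
    by auto
  have "AE x in M. g i x = 0"
    using i g by (subst (asm) integral_nonneg_eq_0_iff_AE) (auto intro!: integrable_unit_bounded)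
  then have "AE x in M. (\<Prod>j\<in>J. g j x powr w j) = 0"
    by eventually_elim (use \<open>finite J\<close> i(1) in \<open>auto intro!: bexI[of _ i]\<close>)
  then have "(\<integral>x. (\<Prod>j\<in>J. g j x powr w j) \<partial>M) = 0"
    by (rule integral_eq_zero_AE)
  then show ?thesis
    by (simp add: prod_nonneg)
next
  case False
  define G where "G j = (\<integral>x. g j x \<partial>M)" for j
  have G: "0 < G j" if "j \<in> J" for j
  proof -
    have "0 \<le> G j"
      unfolding G_def by (rule integral_unit_bounded) (rule g)+
    then show ?thesis
      using False that by (force simp: G_def order_less_le)
  qed
  have int: "integrable M (g j)" if "j \<in> J" for j
    using that g by (auto intro!: integrable_unit_bounded)
  have "(\<integral>x. (\<Prod>j\<in>J. g j x powr w j) \<partial>M)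
      = (\<integral>x. (\<Prod>j\<in>J. G j powr w j) * (\<Prod>j\<in>J. (g j x / G j) powr w j) \<partial>M)"
    unfolding prod.distrib[symmetric]
    using G g by (intro Bochner_Integration.integral_cong prod.cong refl)
      (simp add: powr_mult[symmetric] less_imp_le order_less_imp_not_eq2)
  also have "\<dots> = (\<Prod>j\<in>J. G j powr w j) * (\<integral>x. (\<Prod>j\<in>J. (g j x / G j) powr w j) \<partial>M)"
    by simp
  also have "\<dots> \<le> (\<Prod>j\<in>J. G j powr w j) * 1"
  proof (intro mult_left_mono prod_nonneg)
    have "(\<integral>x. (\<Prod>j\<in>J. (g j x / G j) powr w j) \<partial>M)
        \<le> (\<integral>x. (\<Sum>j\<in>J. w j * (g j x / G j)) + (1 - sum w J) \<partial>M)"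
    proof (intro Bochner_Integration.integral_mono_AE)
      have "integrable M (\<lambda>x. \<Prod>j\<in>J. g j x powr w j)"
        using prod_powr_unit_bounded[of J "\<lambda>j. g j _" w] g w
        by (intro integrable_unit_bounded) auto
      moreover have "(\<Prod>j\<in>J. (g j x / G j) powr w j)
          = (\<Prod>j\<in>J. g j x powr w j) / (\<Prod>j\<in>J. G j powr w j)" for x
        using G g unfolding prod_dividef[symmetric]
        by (intro prod.cong refl) (simp add: powr_divide less_imp_le)
      ultimately show "integrable M (\<lambda>x. \<Prod>j\<in>J. (g j x / G j) powr w j)"
        by simp
      show "integrable M (\<lambda>x. (\<Sum>j\<in>J. w j * (g j x / G j)) + (1 - sum w J))"
        using int by (intro Bochner_Integration.integrable_add Bochner_Integration.integrable_sum) auto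
      show "AE x in M. (\<Prod>j\<in>J. (g j x / G j) powr w j)
          \<le> (\<Sum>j\<in>J. w j * (g j x / G j)) + (1 - sum w J)"
        using G g w \<open>finite J\<close> le1 by (intro AE_I2 weighted_arith_geo_mean) (auto simp: less_imp_le)
    qed
    also have "\<dots> = (\<Sum>j\<in>J. w j * (G j / G j)) + (1 - sum w J)"
      using int by (subst Bochner_Integration.integral_add)
        (auto simp: Bochner_Integration.integral_sum prob_space G_def
          intro!: Bochner_Integration.integrable_sum sum.cong)
    also have "\<dots> = 1"
      using G by (simp add: order_less_imp_not_eq2)
    finally show "(\<integral>x. (\<Prod>j\<in>J. (g j x / G j) powr w j) \<partial>M) \<le> 1" .
  qed auto
  finally show ?thesis
    by (simp add: G_def)
qed

lemma (in product_prob_space) integral_insert_unit_bounded: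
  fixes f :: "('i \<Rightarrow> 'a) \<Rightarrow> real"
  assumes "finite K" "i \<notin> K" "f \<in> borel_measurable (PiM (insert i K) M)"
    and "\<And>x. 0 \<le> f x" "\<And>x. f x \<le> 1"
  shows "(\<integral>x. f x \<partial>PiM (insert i K) M) = (\<integral>x. (\<integral>y. f (x(i := y)) \<partial>M i) \<partial>PiM K M)"
proof -
  interpret K: prob_space "PiM (insert i K) M"
    by (rule prob_space_PiM) unfold_locales
  show ?thesis
    using assms by (intro product_integral_insert K.integrable_unit_bounded)
qed

text \<open>Induction on the set of variables: averaging all factors over one variable
  \<open>v\<close> gives functions of the remaining variables that satisfy the same hypotheses, and
  Hoelder's inequality in \<open>v\<close> bounds the inner integral by their product.\<close>

lemma (in product_prob_space) Finner:
  fixes g :: "'j \<Rightarrow> ('i \<Rightarrow> 'a) \<Rightarrow> real" and w :: "'j \<Rightarrow> real" and S :: "'j \<Rightarrow> 'i set"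
  assumes "finite V" "finite J"
    and "\<And>j. j \<in> J \<Longrightarrow> g j \<in> borel_measurable (PiM V M)"
    and "\<And>j x. 0 \<le> g j x" "\<And>j x. g j x \<le> 1"
    and "\<And>j v x y. j \<in> J \<Longrightarrow> v \<notin> S j \<Longrightarrow> g j (x(v := y)) = g j x"
    and "\<And>j. j \<in> J \<Longrightarrow> 0 \<le> w j"
    and "\<And>v. v \<in> V \<Longrightarrow> (\<Sum>j | j \<in> J \<and> v \<in> S j. w j) \<le> 1"
  shows "(\<integral>x. (\<Prod>j\<in>J. g j x powr w j) \<partial>PiM V M) \<le> (\<Prod>j\<in>J. (\<integral>x. g j x \<partial>PiM V M) powr w j)"
  using assms(1,3-6,8)
proof (induction V arbitrary: g rule: finite_induct)
  case empty
  then show ?case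
    by (simp add: PiM_empty lebesgue_integral_count_space_finite)
next
  case (insert v V)
  note w = assms(7) and [simp] = \<open>finite J\<close>
  note [measurable] = insert.prems(1)
  note g = insert.prems(2,3) and indep = insert.prems(4)
  interpret V: prob_space "PiM V M"
    by (rule prob_space_PiM) unfold_locales
  define g' where "g' j x = (\<integral>y. g j (x(v := y)) \<partial>M v)" for j x
  have g'_bd: "0 \<le> g' j x" "g' j x \<le> 1" for j x
    unfolding g'_def by (auto intro!: M.integral_unit_bounded g)
  have meas_pair: "(\<lambda>p. g j ((fst p)(v := snd p))) \<in> borel_measurable (PiM V M \<Otimes>\<^sub>M M v)"
    if "j \<in> J" for j
    using insert.prems(1)[OF that] measurable_add_dim[of v V M]
    by (auto simp: case_prod_beta' dest!: measurable_compose[rotated])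
  have g'_meas: "g' j \<in> borel_measurable (PiM V M)" if "j \<in> J" for j
    unfolding g'_def using meas_pair[OF that]
    by (intro M.borel_measurable_lebesgue_integral) (simp add: case_prod_beta')
  have meas_v: "(\<lambda>y. g j (x(v := y))) \<in> borel_measurable (M v)"
    if "j \<in> J" "x \<in> space (PiM V M)" for j x
    using measurable_compose[OF measurable_Pair1'[OF that(2), of "M v"] meas_pair[OF that(1)]] by simp
  have int_g: "(\<integral>x. g j x \<partial>PiM (insert v V) M) = (\<integral>x. g' j x \<partial>PiM V M)" if "j \<in> J" for j
    unfolding g'_def using insert.hyps insert.prems(1)[OF that] g
    by (rule integral_insert_unit_bounded)
  have bd: "0 \<le> (\<Prod>j\<in>J. g j x powr w j)" "(\<Prod>j\<in>J. g j x powr w j) \<le> 1" for x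
    using prod_powr_unit_bounded[of J "\<lambda>j. g j x" w] g w by auto
  have bd': "0 \<le> (\<Prod>j\<in>J. g' j x powr w j)" "(\<Prod>j\<in>J. g' j x powr w j) \<le> 1" for x
    using prod_powr_unit_bounded[of J "\<lambda>j. g' j x" w] g'_bd w by auto
  have "(\<integral>x. (\<Prod>j\<in>J. g j x powr w j) \<partial>PiM (insert v V) M)
      = (\<integral>x. (\<integral>y. (\<Prod>j\<in>J. g j (x(v := y)) powr w j) \<partial>M v) \<partial>PiM V M)"
    using bd insert.hyps by (intro integral_insert_unit_bounded) auto
  also have "\<dots> \<le> (\<integral>x. (\<Prod>j\<in>J. g' j x powr w j) \<partial>PiM V M)"
  proof (intro integral_mono)
    fix x assume x: "x \<in> space (PiM V M)"
    \<comment> \<open>Only the factors in \<open>J1\<close> depend on \<open>v\<close>, and the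
      covering condition at \<open>v\<close> says that their weights sum to at most 1. The factors
      in \<open>J2\<close> are constants for the inner integral.\<close>
    define J1 J2 where "J1 = {j \<in> J. v \<in> S j}" and "J2 = {j \<in> J. v \<notin> S j}"
    have J: "J = J1 \<union> J2" "J1 \<inter> J2 = {}" and [simp]: "finite J1" "finite J2"
      by (auto simp: J1_def J2_def)
    have J2: "g j (x(v := y)) = g j x" if "j \<in> J2" for j y
      using that by (intro indep) (auto simp: J2_def)
    then have J2': "g' j x = g j x" if "j \<in> J2" for j
      using that by (simp add: g'_def M.prob_space)
    have "(\<integral>y. (\<Prod>j\<in>J. g j (x(v := y)) powr w j) \<partial>M v)
        = (\<integral>y. (\<Prod>j\<in>J2. g j x powr w j) * (\<Prod>j\<in>J1. g j (x(v := y)) powr w j) \<partial>M v)"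
      unfolding J(1) using J(2) J2 J2' by (simp add: prod.union_disjoint mult.commute)
    also have "\<dots> = (\<Prod>j\<in>J2. g j x powr w j) * (\<integral>y. (\<Prod>j\<in>J1. g j (x(v := y)) powr w j) \<partial>M v)"
      by simp
    also have "\<dots> \<le> (\<Prod>j\<in>J2. g j x powr w j) * (\<Prod>j\<in>J1. g' j x powr w j)"
      unfolding g'_def using x g w insert.prems(5)[of v] meas_v
      by (intro mult_left_mono M.Holder_prod prod_nonneg) (auto simp: J1_def)
    also have "\<dots> = (\<Prod>j\<in>J. g' j x powr w j)"
      unfolding J(1) using J(2) J2 J2' by (simp add: prod.union_disjoint mult.commute)
    finally show "(\<integral>y. (\<Prod>j\<in>J. g j (x(v := y)) powr w j) \<partial>M v) \<le> (\<Prod>j\<in>J. g' j x powr w j)" .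
  next
    show "integrable (PiM V M) (\<lambda>x. \<Prod>j\<in>J. g' j x powr w j)"
      using bd' g'_meas by (intro V.integrable_unit_bounded borel_measurable_prod) auto
    have "(\<lambda>x. \<integral>y. (\<Prod>j\<in>J. g j (x(v := y)) powr w j) \<partial>M v) \<in> borel_measurable (PiM V M)"
      using meas_pair
      by (intro M.borel_measurable_lebesgue_integral) (auto simp: case_prod_beta')
    then show "integrable (PiM V M) (\<lambda>x. \<integral>y. (\<Prod>j\<in>J. g j (x(v := y)) powr w j) \<partial>M v)"
      using bd by (intro V.integrable_unit_bounded M.integral_unit_bounded)
  qed
  also have "\<dots> \<le> (\<Prod>j\<in>J. (\<integral>x. g' j x \<partial>PiM V M) powr w j)"
  proof (rule insert.IH)
    fix j u x y assume j: "j \<in> J" "u \<notin> S j"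
    show "g' j (x(u := y)) = g' j x"
    proof (cases "u = v")
      case False
      have "g j (x(u := y, v := z)) = g j (x(v := z))" for z
        using False by (subst fun_upd_twist) (auto intro!: indep j)
      then show ?thesis
        unfolding g'_def by (rule arg_cong[where f = "integral\<^sup>L (M v)", OF ext])
    qed (simp add: g'_def)
  qed (use g'_meas g'_bd insert.prems(5) in auto)
  finally show ?case
    by (simp add: int_g)
qed

subsection \<open>Densities of complete bipartite graphs\<close>

lemma (in prob_space) Fubini_unit_bounded:
  fixes f :: "'a \<Rightarrow> 'b \<Rightarrow> real"
  assumes "prob_space N" "case_prod f \<in> borel_measurable (M \<Otimes>\<^sub>M N)"
    and "\<And>x y. 0 \<le> f x y" "\<And>x y. f x y \<le> 1"
  shows "(\<integral>x. (\<integral>y. f x y \<partial>N) \<partial>M) = (\<integral>y. (\<integral>x. f x y \<partial>M) \<partial>N)"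
proof -
  interpret N: prob_space N
    by fact
  interpret pair_prob_space M N ..
  show ?thesis
    using assms by (intro Fubini_integral[symmetric] P.integrable_unit_bounded) (auto split: prod.splits)
qed

text \<open>The working substitute for a graphon: measurable for the uncompleted product and
  constrained at all arguments, so that Fubini applies directly and bounds carry no side
  conditions.\<close>

locale kernel = prob_space M for M :: "'a measure" +
  fixes W :: "'a \<Rightarrow> 'a \<Rightarrow> real"
  assumes W_borel: "case_prod W \<in> borel_measurable (M \<Otimes>\<^sub>M M)"
    and W_sym: "W x y = W y x"
    and W_nonneg: "0 \<le> W x y"
    and W_le_1: "W x y \<le> 1"
begin

sublocale P: product_prob_space "\<lambda>_::nat. M" UNIV
  by unfold_locales

abbreviation PM :: "nat set \<Rightarrow> (nat \<Rightarrow> 'a) measure" where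
  "PM I \<equiv> PiM I (\<lambda>_. M)"

lemma prob_space_PM: "prob_space (PM I)"
  by (rule prob_space_PiM) unfold_locales

text \<open>\<open>deg I x\<close> is the normalised number of common neighbours of the vertices \<open>x i\<close>, and
  \<open>bip a b\<close> is the density of \<open>K\<^bsub>a,b\<^esub>\<close>.\<close>

definition deg :: "nat set \<Rightarrow> (nat \<Rightarrow> 'a) \<Rightarrow> real" where
  "deg I x = (\<integral>y. (\<Prod>i\<in>I. W (x i) y) \<partial>M)"

definition bip :: "nat \<Rightarrow> nat \<Rightarrow> real" where
  "bip a b = (\<integral>x. deg {..<a} x ^ b \<partial>PM {..<a})"

lemma measurable_W:
  assumes "f \<in> N \<rightarrow>\<^sub>M M" "g \<in> N \<rightarrow>\<^sub>M M"
  shows "(\<lambda>x. W (f x) (g x)) \<in> borel_measurable N"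
  using measurable_compose[OF measurable_Pair[OF assms] W_borel] by simp

lemma prod_W_bounds:
  "0 \<le> (\<Prod>i\<in>I. W (f i) (g i))" "(\<Prod>i\<in>I. W (f i) (g i)) \<le> 1"
  by (auto intro!: prod_nonneg prod_le_1 W_nonneg W_le_1)

lemma prod2_W_bounds:
  "0 \<le> (\<Prod>i\<in>I. \<Prod>j\<in>J. W (f i j) (g i j))" "(\<Prod>i\<in>I. \<Prod>j\<in>J. W (f i j) (g i j)) \<le> 1"
  by (auto intro!: prod_nonneg prod_le_1 prod_W_bounds W_nonneg W_le_1)

lemma deg_bounds: "0 \<le> deg I x" "deg I x \<le> 1"
  unfolding deg_def by (auto intro!: integral_unit_bounded prod_W_bounds)

lemma deg_power_bounds: "0 \<le> deg I x ^ n" "deg I x ^ n \<le> 1"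
  by (auto intro!: power_le_one zero_le_power deg_bounds)

lemma bip_bounds: "0 \<le> bip a b" "bip a b \<le> 1"
  unfolding bip_def by (auto intro!: prob_space.integral_unit_bounded prob_space_PM deg_power_bounds)

lemma measurable_prod2_W:
  assumes "I \<subseteq> V" "J \<subseteq> U"
  shows "(\<lambda>(x, y). \<Prod>i\<in>I. \<Prod>j\<in>J. W (x i) (y j)) \<in> borel_measurable (PM V \<Otimes>\<^sub>M PM U)"
  unfolding case_prod_beta'
  by (intro borel_measurable_prod measurable_W measurable_compose[OF measurable_fst]
      measurable_compose[OF measurable_snd] measurable_component_singleton) (use assms in auto)

lemma measurable_prod_W:
  assumes "x \<in> space (PM V)" "I \<subseteq> V"
  shows "(\<lambda>y. \<Prod>i\<in>I. W (x i) y) \<in> borel_measurable M"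
  using assms by (intro borel_measurable_prod measurable_W measurable_const measurable_ident)
    (auto simp: space_PiM)

lemma measurable_deg:
  assumes "I \<subseteq> V"
  shows "deg I \<in> borel_measurable (PM V)"
proof -
  have "(\<lambda>(x, y). \<Prod>i\<in>I. W (x i) y) \<in> borel_measurable (PM V \<Otimes>\<^sub>M M)"
    unfolding case_prod_beta'
    by (intro borel_measurable_prod measurable_W measurable_compose[OF measurable_fst]
        measurable_snd measurable_component_singleton) (use assms in auto)
  then show ?thesis
    unfolding deg_def[abs_def] by (rule borel_measurable_lebesgue_integral)
qed

lemma integral_PM_prod:
  assumes "finite J" "h \<in> borel_measurable M" "\<And>y. 0 \<le> h y" "\<And>y. h y \<le> (1::real)"
  shows "(\<integral>y. (\<Prod>j\<in>J. h (y j)) \<partial>PM J) = (\<integral>y. h y \<partial>M) ^ card J"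
  using assms by (subst P.product_integral_prod) (auto intro!: integrable_unit_bounded)

text \<open>Coordinates outside \<open>S\<close> enter only through their own factor
  \<open>h\<close>, so each contributes the mean of \<open>h\<close>. This integrates out vertices
  that are attached to a fixed set and to nothing else.\<close>

lemma integral_PM_split:
  assumes V: "finite V" "S \<subseteq> V"
    and h: "h \<in> borel_measurable M" "\<And>y. 0 \<le> h y" "\<And>y. h y \<le> (1::real)"
    and G: "G \<in> borel_measurable (PM V)" "\<And>x. 0 \<le> G x" "\<And>x. G x \<le> 1"
      "\<And>x x'. (\<And>i. i \<in> S \<Longrightarrow> x i = x' i) \<Longrightarrow> G x = G x'"
  shows "(\<integral>x. (\<Prod>i\<in>V. h (x i)) * G x \<partial>PM V)
      = (\<integral>y. h y \<partial>M) ^ card (V - S) * (\<integral>x. (\<Prod>i\<in>S. h (x i)) * G x \<partial>PM S)"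
proof -
  have VS: "V = S \<union> (V - S)" and fin: "finite S"
    using V finite_subset[of S V] by blast+
  interpret V: prob_space "PM V"
    by (rule prob_space_PM)
  have m: "(\<lambda>x. (\<Prod>i\<in>V. h (x i)) * G x) \<in> borel_measurable (PM V)"
    by (intro borel_measurable_times borel_measurable_prod G(1)
        measurable_compose[OF _ h(1)] measurable_component_singleton)
  have bd: "0 \<le> (\<Prod>i\<in>V. h (x i)) * G x" "(\<Prod>i\<in>V. h (x i)) * G x \<le> 1" for x
    using h G(2,3) by (auto intro!: mult_nonneg_nonneg mult_le_one prod_nonneg prod_le_1)
  have "(\<integral>x. (\<Prod>i\<in>V. h (x i)) * G x \<partial>PM V)
      = (\<integral>x. (\<integral>y. (\<Prod>i\<in>V. h (merge S (V - S) (x, y) i)) * G (merge S (V - S) (x, y))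
          \<partial>PM (V - S)) \<partial>PM S)"
  proof -
    have "integrable (PM (S \<union> (V - S))) (\<lambda>x. (\<Prod>i\<in>V. h (x i)) * G x)"
      unfolding VS[symmetric] by (rule V.integrable_unit_bounded[OF m bd])
    from P.product_integral_fold[OF _ fin _ this] V(1) show ?thesis
      unfolding VS[symmetric] by blast
  qed
  also have "\<dots> = (\<integral>x. (\<integral>y. ((\<Prod>i\<in>S. h (x i)) * G x) * (\<Prod>i\<in>V - S. h (y i)) \<partial>PM (V - S)) \<partial>PM S)"
  proof (intro Bochner_Integration.integral_cong refl)
    fix x y
    have "(\<Prod>i\<in>V. h (merge S (V - S) (x, y) i))
        = (\<Prod>i\<in>S. h (merge S (V - S) (x, y) i)) * (\<Prod>i\<in>V - S. h (merge S (V - S) (x, y) i))"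
      using prod.subset_diff[OF V(2,1)] by (simp only: mult.commute)
    also have "\<dots> = (\<Prod>i\<in>S. h (x i)) * (\<Prod>i\<in>V - S. h (y i))"
      by (simp add: merge_def)
    moreover have "G (merge S (V - S) (x, y)) = G x"
      by (rule G(4)) auto
    ultimately show "(\<Prod>i\<in>V. h (merge S (V - S) (x, y) i)) * G (merge S (V - S) (x, y))
        = ((\<Prod>i\<in>S. h (x i)) * G x) * (\<Prod>i\<in>V - S. h (y i))"
      by (simp add: mult_ac)
  qed
  also have "\<dots> = (\<integral>x. ((\<Prod>i\<in>S. h (x i)) * G x) * (\<integral>y. h y \<partial>M) ^ card (V - S) \<partial>PM S)"
    using V h by (simp add: integral_PM_prod)
  finally show ?thesis
    by (simp add: mult.commute)
qed

lemma deg_power_eq_integral: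
  assumes "x \<in> space (PM V)" "I \<subseteq> V" "finite J"
  shows "deg I x ^ card J = (\<integral>y. (\<Prod>i\<in>I. \<Prod>j\<in>J. W (x i) (y j)) \<partial>PM J)"
proof -
  have "deg I x ^ card J = (\<integral>y. (\<Prod>j\<in>J. \<Prod>i\<in>I. W (x i) (y j)) \<partial>PM J)"
    unfolding deg_def using assms
    by (subst integral_PM_prod) (auto intro!: measurable_prod_W prod_W_bounds)
  also have "\<dots> = (\<integral>y. (\<Prod>i\<in>I. \<Prod>j\<in>J. W (x i) (y j)) \<partial>PM J)"
    by (intro Bochner_Integration.integral_cong refl prod.swap)
  finally show ?thesis .
qed

text \<open>Both sides are the density of the complete bipartite graph between \<open>S\<close> and
  \<open>J\<close>, with the two sides integrated in opposite orders. Coordinates of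
  \<open>V\<close> outside \<open>S\<close> integrate to 1, which lets factors over different
  subsets share one space in the packing argument.\<close>

lemma integral_deg_power_swap:
  assumes V: "finite V" "S \<subseteq> V" and J: "finite J"
  shows "(\<integral>x. deg S x ^ card J \<partial>PM V) = (\<integral>y. deg J y ^ card S \<partial>PM J)"
proof -
  interpret V: prob_space "PM V"
    by (rule prob_space_PM)
  have "(\<integral>x. deg S x ^ card J \<partial>PM V)
      = (\<integral>x. (\<integral>y. (\<Prod>i\<in>S. \<Prod>j\<in>J. W (x i) (y j)) \<partial>PM J) \<partial>PM V)"
    using assms by (intro Bochner_Integration.integral_cong refl deg_power_eq_integral)
  also have "\<dots> = (\<integral>y. (\<integral>x. (\<Prod>i\<in>S. \<Prod>j\<in>J. W (x i) (y j)) \<partial>PM V) \<partial>PM J)"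
    using assms measurable_prod2_W[of S V J J]
    by (intro V.Fubini_unit_bounded prob_space_PM prod2_W_bounds) auto
  also have "\<dots> = (\<integral>y. deg J y ^ card S \<partial>PM J)"
  proof (intro Bochner_Integration.integral_cong refl)
    fix y assume y: "y \<in> space (PM J)"
    have "(\<integral>x. (\<Prod>i\<in>S. \<Prod>j\<in>J. W (x i) (y j)) \<partial>PM V)
        = (\<integral>x. (\<Prod>i\<in>V. if i \<in> S then \<Prod>j\<in>J. W (y j) (x i) else 1) \<partial>PM V)"
    proof (intro Bochner_Integration.integral_cong refl)
      fix x
      show "(\<Prod>i\<in>S. \<Prod>j\<in>J. W (x i) (y j))
          = (\<Prod>i\<in>V. if i \<in> S then \<Prod>j\<in>J. W (y j) (x i) else 1)"
        using V unfolding prod.inter_filter[OF V(1), symmetric]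
        by (intro prod.cong) (auto simp: W_sym)
    qed
    also have "\<dots> = (\<Prod>i\<in>V. \<integral>z. (if i \<in> S then \<Prod>j\<in>J. W (y j) z else 1) \<partial>M)"
    proof (intro P.product_integral_prod V)
      fix i
      show "integrable M (\<lambda>z. if i \<in> S then \<Prod>j\<in>J. W (y j) z else 1)"
        using measurable_prod_W[OF y order_refl]
        by (cases "i \<in> S") (auto intro!: integrable_unit_bounded prod_W_bounds)
    qed
    also have "\<dots> = (\<Prod>i\<in>V. if i \<in> S then deg J y else 1)"
      by (intro prod.cong refl) (simp add: deg_def prob_space)
    also have "\<dots> = deg J y ^ card S"
      using V by (subst prod.inter_filter[OF V(1), symmetric]) (auto simp: Int_absorb1 Collect_conj_eq)
    finally show "(\<integral>x. (\<Prod>i\<in>S. \<Prod>j\<in>J. W (x i) (y j)) \<partial>PM V) = deg J y ^ card S" .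
  qed
  finally show ?thesis .
qed

lemma integral_deg_power:
  assumes "finite V" "S \<subseteq> V"
  shows "(\<integral>x. deg S x ^ q \<partial>PM V) = bip q (card S)"
  using integral_deg_power_swap[OF assms, of "{..<q}"] by (simp add: bip_def)

lemma bip_commute: "bip a b = bip b a"
  using integral_deg_power[of "{..<a}" "{..<a}" b] by (simp add: bip_def)

lemma deg_antimono:
  assumes "x \<in> space (PM V)" "S \<subseteq> I" "I \<subseteq> V" "finite V"
  shows "deg I x \<le> deg S x"
  unfolding deg_def
proof (intro integral_mono integrable_unit_bounded prod_W_bounds)
  fix y
  have "(\<Prod>i\<in>I. W (x i) y) = (\<Prod>i\<in>I - S. W (x i) y) * (\<Prod>i\<in>S. W (x i) y)"
    using assms by (intro prod.subset_diff) (auto intro: finite_subset)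
  also have "\<dots> \<le> 1 * (\<Prod>i\<in>S. W (x i) y)"
    by (intro mult_right_mono prod_W_bounds)
  finally show "(\<Prod>i\<in>I. W (x i) y) \<le> (\<Prod>i\<in>S. W (x i) y)"
    by simp
qed (use assms in \<open>auto intro!: measurable_prod_W\<close>)

lemma bip_antimono:
  assumes "b' \<le> b"
  shows "bip a b \<le> bip a b'"
  unfolding bip_def
  using assms
  by (intro integral_mono prob_space.integrable_unit_bounded prob_space_PM borel_measurable_power
      measurable_deg deg_power_bounds power_decreasing deg_bounds order_refl)

lemma bip_Jensen:
  assumes "0 < b'" "b' \<le> b"
  shows "bip a b' powr (real b / real b') \<le> bip a b"
proof -
  interpret V: prob_space "PM {..<a}"
    by (rule prob_space_PM)
  define w where "w = real b' / real b"
  \<comment> \<open>Jensen's inequality for the concave power \<open>w\<close> is the case of a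
    single factor in \<open>Holder_prod\<close>.\<close>
  have "(\<integral>x. (\<Prod>j\<in>{()}. (deg {..<a} x ^ b) powr w) \<partial>PM {..<a})
      \<le> (\<Prod>j\<in>{()}. (\<integral>x. deg {..<a} x ^ b \<partial>PM {..<a}) powr w)"
    using assms
    by (intro V.Holder_prod borel_measurable_power measurable_deg deg_power_bounds)
      (auto simp: w_def)
  also have "(\<integral>x. (\<Prod>j\<in>{()}. (deg {..<a} x ^ b) powr w) \<partial>PM {..<a}) = bip a b'"
    unfolding bip_def
  proof (intro Bochner_Integration.integral_cong refl)
    fix x
    show "(\<Prod>j\<in>{()}. (deg {..<a} x ^ b) powr w) = deg {..<a} x ^ b'"
    proof (cases "deg {..<a} x = 0")
      case False
      then have "0 < deg {..<a} x"
        using deg_bounds[of "{..<a}" x] by simp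
      then show ?thesis
        using assms by (simp add: w_def powr_powr flip: powr_realpow)
    qed (use assms in \<open>simp add: zero_power\<close>)
  qed
  finally have "bip a b' \<le> bip a b powr w"
    by (simp add: bip_def)
  then have "bip a b' powr (real b / real b') \<le> (bip a b powr w) powr (real b / real b')"
    by (intro powr_mono2 bip_bounds) auto
  also have "\<dots> = bip a b"
    using assms bip_bounds[of a b] by (cases "bip a b = 0") (auto simp: powr_powr w_def)
  finally show ?thesis .
qed

text \<open>Only the edges of \<open>K\<^bsub>k+m,k+n\<^esub>\<close> meeting a fixed \<open>K\<^bsub>k,k\<^esub>\<close> are kept. What remains is this
  \<open>K\<^bsub>k,k\<^esub>\<close> with \<open>m\<close> and \<open>n\<close> vertices attached to its two sides, and attaching all of them to the
  same side increases the density, by Chebyshev's sum inequality.\<close>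

lemma bip_unbalance_aux: "bip (k + m) (k + n) \<le> bip k (k + n + m)"
proof -
  define S where "S = {..<k}"
  define V where "V = {..<k + m}"
  define K where "K x y = (\<Prod>i\<in>S. \<Prod>j\<in>S. W (x i) (y j))" for x y
  \<comment> \<open>The density of K_{k,k} with \<open>p\<close> further vertices joined to all of
    \<open>x\<close> and \<open>q\<close> further vertices joined to all of
    \<open>y\<close>.\<close>
  define Q where "Q p q = (\<integral>x. (\<integral>y. K x y * (deg S x ^ p * deg S y ^ q) \<partial>PM S) \<partial>PM S)" for p q
  have fin: "finite S" "finite V" "S \<subseteq> V" "card S = k" "card (V - S) = m"
    by (auto simp: S_def V_def card_Diff_subset)
  interpret S: prob_space "PM S"
    by (rule prob_space_PM)
  interpret V: prob_space "PM V"
    by (rule prob_space_PM)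
  interpret SS: pair_prob_space "PM S" "PM S" ..
  have dx: "(\<lambda>z. deg S (fst z)) \<in> borel_measurable (PM U \<Otimes>\<^sub>M PM S)"
    and dy: "(\<lambda>z. deg S (snd z)) \<in> borel_measurable (PM U \<Otimes>\<^sub>M PM S)" if "S \<subseteq> U" for U
    using measurable_compose[OF measurable_fst measurable_deg[OF that]]
      measurable_compose[OF measurable_snd measurable_deg[OF order_refl]] by auto
  have K_meas: "(\<lambda>z. K (fst z) (snd z)) \<in> borel_measurable (PM S \<Otimes>\<^sub>M PM S)"
    using measurable_prod2_W[of S S S S] by (simp add: K_def case_prod_beta')
  have Q_meas: "(\<lambda>(x, y). K x y * (deg S x ^ p * deg S y ^ q)) \<in> borel_measurable (PM S \<Otimes>\<^sub>M PM S)"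
    for p q
    using K_meas dx[of S] dy[of S] unfolding case_prod_beta'
    by (intro borel_measurable_times borel_measurable_power) auto
  have K_bd: "0 \<le> K x y" "K x y \<le> 1" for x y
    unfolding K_def by (rule prod2_W_bounds)+
  have Q_bd: "0 \<le> K x y * (deg S x ^ p * deg S y ^ q)" "K x y * (deg S x ^ p * deg S y ^ q) \<le> 1"
    for x y p q
    by (auto intro!: mult_nonneg_nonneg mult_le_one K_bd deg_power_bounds)
  have K_sym: "K x y = K y x" for x y
    unfolding K_def by (subst prod.swap) (simp add: W_sym)
  have Q_sym: "Q p q = Q q p" for p q
  proof -
    have "Q p q = (\<integral>y. (\<integral>x. K x y * (deg S x ^ p * deg S y ^ q) \<partial>PM S) \<partial>PM S)"
      unfolding Q_def by (rule S.Fubini_unit_bounded[OF S.prob_space_axioms Q_meas Q_bd])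
    also have "\<dots> = Q q p"
      unfolding Q_def
      by (intro Bochner_Integration.integral_cong refl arg_cong2[where f = times] K_sym mult.commute)
    finally show ?thesis .
  qed
  have Q_0: "Q p 0 = bip k (k + p)" for p
  proof -
    have "Q p 0 = (\<integral>x. deg S x ^ p * (\<integral>y. K x y \<partial>PM S) \<partial>PM S)"
      by (simp add: Q_def mult.commute)
    also have "\<dots> = (\<integral>x. deg S x ^ p * deg S x ^ k \<partial>PM S)"
      using deg_power_eq_integral[of _ S S S] fin
      by (intro Bochner_Integration.integral_cong) (auto simp: K_def)
    finally show ?thesis
      by (simp add: bip_def S_def power_add mult.commute)
  qed
  have int: "integrable (PM S \<Otimes>\<^sub>M PM S) (\<lambda>(x, y). K x y * (deg S x ^ p * deg S y ^ q))" for p q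
    using Q_meas Q_bd by (intro SS.P.integrable_unit_bounded) auto
  have Q_pair: "Q p q = (\<integral>(x, y). K x y * (deg S x ^ p * deg S y ^ q) \<partial>(PM S \<Otimes>\<^sub>M PM S))" for p q
    unfolding Q_def using SS.integral_fst'[OF int] by simp
  \<comment> \<open>Exchanging \<open>x\<close> and \<open>y\<close> shows that \<open>Q\<close> is
    symmetric, so each side is twice one term. Pointwise the inequality says that u^n - v^n and u^m
    - v^m have the same sign.\<close>
  have "Q n m + Q m n \<le> Q (n + m) 0 + Q 0 (n + m)"
    unfolding Q_pair
    using int[of n m] int[of m n] int[of "n + m" 0] int[of 0 "n + m"]
  proof (subst (1 2) Bochner_Integration.integral_add[symmetric], goal_cases)
    case 5
    show ?case
    proof (rule integral_mono, goal_cases)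
      case (3 z)
      obtain x y where z: "z = (x, y)"
        by force
      have "0 \<le> (deg S x ^ n - deg S y ^ n) * (deg S x ^ m - deg S y ^ m)"
        using power_mono[of "deg S x" "deg S y"] power_mono[of "deg S y" "deg S x"] deg_bounds
        by (cases "deg S x \<le> deg S y") (auto intro!: mult_nonneg_nonneg mult_nonpos_nonpos)
      then have "deg S x ^ n * deg S y ^ m + deg S x ^ m * deg S y ^ n
          \<le> deg S x ^ (n + m) + deg S y ^ (n + m)"
        by (simp add: algebra_simps power_add)
      from mult_left_mono[OF this K_bd(1)[of x y]] show ?case
        by (simp add: z distrib_left)
    qed (intro Bochner_Integration.integrable_add int)+
  qed auto
  then have Q_le: "Q n m \<le> bip k (k + n + m)"
    using Q_sym[of n m] Q_sym[of 0 "n + m"] Q_0[of "n + m"] by (simp add: add.assoc)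
  have h_meas: "(\<lambda>z. \<Prod>j\<in>S. W z (y j)) \<in> borel_measurable M" if "y \<in> space (PM S)" for y
    using measurable_prod_W[OF that order_refl] by (simp add: W_sym)
  have h_int: "(\<integral>z. (\<Prod>j\<in>S. W z (y j)) \<partial>M) = deg S y" for y
    by (simp add: deg_def W_sym)
  have "bip (k + m) (k + n) = (\<integral>x. deg V x ^ k * deg V x ^ n \<partial>PM V)"
    by (simp add: bip_def V_def power_add)
  \<comment> \<open>The \<open>n\<close> extra vertices keep only their edges to \<open>S\<close>;
    the edges between the two sets of extra vertices are deleted here.\<close>
  also have "\<dots> \<le> (\<integral>x. deg V x ^ k * deg S x ^ n \<partial>PM V)"
    using fin
    by (intro integral_mono V.integrable_unit_bounded borel_measurable_times borel_measurable_power
        measurable_deg mult_nonneg_nonneg mult_le_one deg_power_bounds mult_left_mono power_mono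
        deg_antimono[where V = V] deg_bounds) auto
  also have "\<dots> = (\<integral>x. (\<integral>y. (\<Prod>i\<in>V. \<Prod>j\<in>S. W (x i) (y j)) * deg S x ^ n \<partial>PM S) \<partial>PM V)"
    using deg_power_eq_integral[of _ V V S] fin
    by (intro Bochner_Integration.integral_cong) auto
  also have "\<dots> = (\<integral>y. (\<integral>x. (\<Prod>i\<in>V. \<Prod>j\<in>S. W (x i) (y j)) * deg S x ^ n \<partial>PM V) \<partial>PM S)"
    using measurable_prod2_W[of V V S S] dx[of V] fin
    by (intro V.Fubini_unit_bounded S.prob_space_axioms mult_nonneg_nonneg mult_le_one
        prod2_W_bounds deg_power_bounds) (auto simp: case_prod_beta')
  also have "\<dots> = (\<integral>y. (\<integral>x. K x y * (deg S x ^ n * deg S y ^ m) \<partial>PM S) \<partial>PM S)"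
  proof (rule Bochner_Integration.integral_cong[OF refl])
    fix y assume y: "y \<in> space (PM S)"
    have "(\<integral>x. (\<Prod>i\<in>V. \<Prod>j\<in>S. W (x i) (y j)) * deg S x ^ n \<partial>PM V)
        = deg S y ^ m * (\<integral>x. (\<Prod>i\<in>S. \<Prod>j\<in>S. W (x i) (y j)) * deg S x ^ n \<partial>PM S)"
      unfolding h_int[of y, symmetric] fin(5)[symmetric]
    proof (rule integral_PM_split[OF fin(2,3) h_meas[OF y] prod_W_bounds
          borel_measurable_power[OF measurable_deg[OF fin(3)]] deg_power_bounds])
      show "deg S x ^ n = deg S x' ^ n" if "\<And>i. i \<in> S \<Longrightarrow> x i = x' i" for x x' :: "nat \<Rightarrow> 'a"
        using that by (simp add: deg_def cong: prod.cong)
    qed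
    also have "\<dots> = (\<integral>x. deg S y ^ m * (K x y * deg S x ^ n) \<partial>PM S)"
      by (simp add: K_def)
    finally show "(\<integral>x. (\<Prod>i\<in>V. \<Prod>j\<in>S. W (x i) (y j)) * deg S x ^ n \<partial>PM V)
        = (\<integral>x. K x y * (deg S x ^ n * deg S y ^ m) \<partial>PM S)"
      by (simp only: mult.commute[of "deg S y ^ m"] mult.assoc)
  qed
  also have "\<dots> = Q n m"
    unfolding Q_def by (rule S.Fubini_unit_bounded[OF S.prob_space_axioms Q_meas Q_bd, symmetric])
  finally show ?thesis
    using Q_le by simp
qed

lemma bip_unbalance:
  assumes "k \<le> a" "k \<le> b"
  shows "bip a b \<le> bip k (a + b - k)"
  using bip_unbalance_aux[of k "a - k" "b - k"] assms by (simp add: add.commute)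

end

section \<open>Fractional packings by smaller complete bipartite graphs\<close>

lemma card_subsets_containing:
  assumes "finite A" "v \<in> A" "0 < p"
  shows "card {S. S \<subseteq> A \<and> card S = p \<and> v \<in> S} = (card A - 1) choose (p - 1)"
proof -
  have "{S. S \<subseteq> A \<and> card S = p \<and> v \<in> S} = insert v ` {S. S \<subseteq> A - {v} \<and> card S = p - 1}"
  proof (intro set_eqI iffI)
    fix S assume "S \<in> {S. S \<subseteq> A \<and> card S = p \<and> v \<in> S}"
    then have "S = insert v (S - {v})" "S - {v} \<in> {S. S \<subseteq> A - {v} \<and> card S = p - 1}"
      by auto
    then show "S \<in> insert v ` {S. S \<subseteq> A - {v} \<and> card S = p - 1}"
      by blast
  next
    fix S assume "S \<in> insert v ` {S. S \<subseteq> A - {v} \<and> card S = p - 1}"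
    then obtain R where R: "S = insert v R" "R \<subseteq> A - {v}" "card R = p - 1"
      by auto
    then have "finite R"
      using assms finite_subset by blast
    then show "S \<in> {S. S \<subseteq> A \<and> card S = p \<and> v \<in> S}"
      using R assms by (auto simp: card_insert_if)
  qed
  moreover have "inj_on (insert v) {S. S \<subseteq> A - {v} \<and> card S = p - 1}"
    by (intro inj_onI) (metis Diff_insert_absorb insert_Diff_single mem_Collect_eq subset_Diff_insert)
  ultimately show ?thesis
    using n_subsets[of "A - {v}" "p - 1"] assms by (simp add: card_image)
qed

context kernel
begin

text \<open>The weight of type \<open>t\<close> is spread evenly over all subsets of
  \<open>V\<close> of size \<open>p t\<close>; by symmetry every vertex then carries the same load,
  the sum of \<open>\<alpha> t * p t\<close> divided by \<open>a\<close>, which is at most 1 as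
  Finner requires. The condition on \<open>q\<close> is used pointwise: \<open>deg V x\<close> is at
  most 1 and at most every \<open>deg S x\<close>, so lowering the total exponent from
  \<open>b\<close> and passing to subsets both increase the integrand.\<close>

lemma bip_packing:
  fixes p q :: "'t \<Rightarrow> nat" and \<alpha> :: "'t \<Rightarrow> real"
  assumes T: "finite T" "T \<noteq> {}" and "0 < b"
    and p: "\<And>t. t \<in> T \<Longrightarrow> 0 < p t" "\<And>t. t \<in> T \<Longrightarrow> p t \<le> a"
    and \<alpha>: "\<And>t. t \<in> T \<Longrightarrow> 0 \<le> \<alpha> t"
    and a: "(\<Sum>t\<in>T. \<alpha> t * real (p t)) \<le> real a" and b: "(\<Sum>t\<in>T. \<alpha> t * real (q t)) \<le> real b"
    and \<tau>: "\<And>t. t \<in> T \<Longrightarrow> bip (p t) (q t) \<le> \<tau>"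
  shows "bip a b \<le> \<tau> powr (\<Sum>t\<in>T. \<alpha> t)"
proof -
  define V where "V = {..<a}"
  define F where "F t = {S. S \<subseteq> V \<and> card S = p t}" for t
  define J where "J = Sigma T F"
  define w where "w j = \<alpha> (fst j) / real (a choose p (fst j))" for j :: "'t \<times> nat set"
  have V: "finite V" "card V = a"
    by (auto simp: V_def)
  have F: "finite (F t)" "card (F t) = a choose p t" for t
    using V n_subsets[of V "p t"] by (auto simp: F_def)
  have choose_pos: "0 < a choose p t" if "t \<in> T" for t
    using p(2)[OF that] by (simp add: zero_less_binomial)
  have J: "finite J"
    using T F by (auto simp: J_def)
  have w_nonneg: "0 \<le> w j" if "j \<in> J" for j
    using that \<alpha> by (auto simp: w_def J_def)
  have sum_w: "(\<Sum>j\<in>J. w j * f (fst j)) = (\<Sum>t\<in>T. \<alpha> t * f t)" for f :: "'t \<Rightarrow> real"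
  proof -
    have "(\<Sum>j\<in>J. w j * f (fst j)) = (\<Sum>t\<in>T. \<Sum>S\<in>F t. w (t, S) * f t)"
      unfolding J_def using T F by (subst sum.Sigma) (auto intro!: sum.cong)
    also have "\<dots> = (\<Sum>t\<in>T. \<alpha> t * f t)"
    proof (intro sum.cong refl)
      fix t assume "t \<in> T"
      then have "a choose p t \<noteq> 0"
        using choose_pos by force
      then show "(\<Sum>S\<in>F t. w (t, S) * f t) = \<alpha> t * f t"
        using F by (simp add: w_def)
    qed
    finally show ?thesis .
  qed
  have cover: "(\<Sum>j | j \<in> J \<and> v \<in> snd j. w j) \<le> 1" if v: "v \<in> V" for v
  proof -
    have "0 < a"
      using v by (auto simp: V_def)
    have "{j. j \<in> J \<and> v \<in> snd j} = Sigma T (\<lambda>t. {S. S \<subseteq> V \<and> card S = p t \<and> v \<in> S})"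
      by (auto simp: J_def F_def)
    then have "(\<Sum>j | j \<in> J \<and> v \<in> snd j. w j)
        = (\<Sum>t\<in>T. \<Sum>S\<in>{S. S \<subseteq> V \<and> card S = p t \<and> v \<in> S}. w (t, S))"
      using T V by (simp add: sum.Sigma)
    also have "\<dots> = (\<Sum>t\<in>T. \<alpha> t * real (p t) / real a)"
    proof (intro sum.cong refl)
      fix t assume t: "t \<in> T"
      \<comment> \<open>A fraction \<open>p t / a\<close> of the subsets of size \<open>p t\<close>
        contains a given vertex.\<close>
      have "p t * (a choose p t) = a * ((a - 1) choose (p t - 1))"
        using p(1)[OF t] \<open>0 < a\<close> Suc_times_binomial_eq[of "a - 1" "p t - 1"]
        by (simp add: mult.commute)
      then have "real (p t) * real (a choose p t) = real a * real ((a - 1) choose (p t - 1))"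
        by (metis of_nat_mult)
      then show "(\<Sum>S\<in>{S. S \<subseteq> V \<and> card S = p t \<and> v \<in> S}. w (t, S)) = \<alpha> t * real (p t) / real a"
        using card_subsets_containing[OF V(1) v p(1)[OF t]] V choose_pos[OF t] \<open>0 < a\<close>
        by (simp add: w_def field_simps)
    qed
    also have "\<dots> = (\<Sum>t\<in>T. \<alpha> t * real (p t)) / real a"
      by (simp add: sum_divide_distrib)
    also have "\<dots> \<le> 1"
      using a \<open>0 < a\<close> by simp
    finally show ?thesis .
  qed
  have sub: "snd j \<subseteq> V" "card (snd j) = p (fst j)" "fst j \<in> T" if "j \<in> J" for j
    using that by (auto simp: J_def F_def)
  interpret V: prob_space "PM V"
    by (rule prob_space_PM)
  have g_meas: "(\<lambda>x. deg (snd j) x ^ q (fst j)) \<in> borel_measurable (PM V)" if "j \<in> J" for j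
    by (intro borel_measurable_power measurable_deg sub that)
  have "bip a b = (\<integral>x. deg V x ^ b \<partial>PM V)"
    by (simp add: bip_def V_def)
  also have "\<dots> \<le> (\<integral>x. (\<Prod>j\<in>J. (deg (snd j) x ^ q (fst j)) powr w j) \<partial>PM V)"
  proof (rule integral_mono)
    show "integrable (PM V) (\<lambda>x. deg V x ^ b)"
      by (intro V.integrable_unit_bounded borel_measurable_power measurable_deg deg_power_bounds order_refl)
    show "integrable (PM V) (\<lambda>x. \<Prod>j\<in>J. (deg (snd j) x ^ q (fst j)) powr w j)"
      using g_meas
      by (intro V.integrable_unit_bounded borel_measurable_prod prod_powr_unit_bounded
          deg_power_bounds w_nonneg) auto
  next
    fix x assume x: "x \<in> space (PM V)"
    show "deg V x ^ b \<le> (\<Prod>j\<in>J. (deg (snd j) x ^ q (fst j)) powr w j)"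
    proof (cases "deg V x = 0")
      case True
      then show ?thesis
        using \<open>0 < b\<close> by (simp add: zero_power prod_nonneg)
    next
      case False
      then have pos: "0 < deg V x"
        using deg_bounds(1)[of V x] by simp
      have "(\<Sum>j\<in>J. w j * real (q (fst j))) \<le> real b"
        using sum_w[of "\<lambda>t. real (q t)"] b by simp
      then have "deg V x ^ b \<le> deg V x powr (\<Sum>j\<in>J. w j * real (q (fst j)))"
        using pos deg_bounds(2)[of V x] by (simp add: powr_mono' flip: powr_realpow)
      also have "\<dots> = (\<Prod>j\<in>J. (deg V x ^ q (fst j)) powr w j)"
        using pos J by (simp add: powr_sum powr_powr mult.commute flip: powr_realpow)
      also have "\<dots> \<le> (\<Prod>j\<in>J. (deg (snd j) x ^ q (fst j)) powr w j)"
        using x V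
        by (intro prod_mono conjI powr_mono2 power_mono deg_antimono[where V = V] deg_bounds
            deg_power_bounds sub w_nonneg) auto
      finally show ?thesis .
    qed
  qed
  also have "\<dots> \<le> (\<Prod>j\<in>J. (\<integral>x. deg (snd j) x ^ q (fst j) \<partial>PM V) powr w j)"
  proof (rule P.Finner[where S = snd])
    fix j :: "'t \<times> nat set" and v x y
    assume "v \<notin> snd j"
    then have "deg (snd j) (x(v := y)) = deg (snd j) x"
      unfolding deg_def by (intro Bochner_Integration.integral_cong prod.cong) auto
    then show "deg (snd j) (x(v := y)) ^ q (fst j) = deg (snd j) x ^ q (fst j)"
      by simp
  qed (use V J g_meas w_nonneg cover deg_power_bounds in auto)
  also have "\<dots> = (\<Prod>j\<in>J. bip (p (fst j)) (q (fst j)) powr w j)"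
    using integral_deg_power[OF V(1) sub(1)] sub(2) bip_commute by (intro prod.cong) auto
  also have "\<dots> \<le> (\<Prod>j\<in>J. \<tau> powr w j)"
    using \<tau> sub by (intro prod_mono conjI powr_mono2 bip_bounds w_nonneg) auto
  also have "\<dots> = \<tau> powr (\<Sum>t\<in>T. \<alpha> t)"
  proof (cases "\<tau> = 0")
    \<comment> \<open>Here the right side is 0 whatever the exponent, so the product must have a
      factor: \<open>T\<close> is nonempty and \<open>p t \<le> a\<close> provides a subset of that
      size.\<close>
    case True
    obtain t where "t \<in> T"
      using T by blast
    moreover have "F t \<noteq> {}"
      using choose_pos[OF \<open>t \<in> T\<close>] F(2)[of t] by auto
    ultimately have "J \<noteq> {}"
      by (auto simp: J_def)
    then show ?thesis
      using True J by (auto simp: prod_zero_iff)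
  next
    case False
    then show ?thesis
      using J sum_w[of "\<lambda>_. 1"] by (simp add: powr_sum[symmetric])
  qed
  finally show ?thesis .
qed

section \<open>Upper bounds on the exponent, case by case\<close>

lemma bip_powr_le_if_le_powr:
  assumes "bip a b \<le> bip a' b' powr (1 / c)" "0 < c"
  shows "bip a b powr c \<le> bip a' b'"
proof -
  have "bip a b powr c \<le> (bip a' b' powr (1 / c)) powr c"
    using assms bip_bounds by (intro powr_mono2) auto
  also have "\<dots> = bip a' b'"
    using assms bip_bounds(1)[of a' b'] by (cases "bip a' b' = 0") (auto simp: powr_powr)
  finally show ?thesis .
qed

text \<open>Jensen's inequality enlarges one side at a time, and the two exponents multiply.\<close>

lemma bip_ge_both_larger:
  assumes "0 < a1" "0 < a2" "a1 \<le> b1" "a2 \<le> b2"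
  shows "bip a1 a2 powr (real (b1 * b2) / real (a1 * a2)) \<le> bip b1 b2"
proof -
  have "bip a1 a2 powr (real (b1 * b2) / real (a1 * a2))
      = (bip a2 a1 powr (real b1 / real a1)) powr (real b2 / real a2)"
    by (simp add: powr_powr bip_commute)
  also have "\<dots> \<le> bip a2 b1 powr (real b2 / real a2)"
    using assms by (intro powr_mono2 bip_Jensen) auto
  also have "\<dots> \<le> bip b1 b2"
    using bip_Jensen[of a2 b2 b1] assms by (simp add: bip_commute)
  finally show ?thesis .
qed

text \<open>Shrinking the first side to \<open>b1\<close> only raises the density; the exponent is
  paid solely for enlarging the second side.\<close>

lemma bip_ge_second_larger:
  assumes "0 < a2" "b1 \<le> a1" "a2 \<le> b2"
  shows "bip a1 a2 powr (real b2 / real a2) \<le> bip b1 b2"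
proof -
  have "bip a1 a2 powr (real b2 / real a2) \<le> bip b1 a2 powr (real b2 / real a2)"
    using bip_antimono[of b1 a1 a2] assms bip_bounds
    by (intro powr_mono2) (auto simp: bip_commute)
  also have "\<dots> \<le> bip b1 b2"
    using assms by (intro bip_Jensen) auto
  finally show ?thesis .
qed

text \<open>A packing by one type, K_{b1,b2} with weight a2/b2. It fills the second side exactly,
  and the product hypothesis says that it fits on the first.\<close>

lemma bip_ge_both_smaller:
  assumes "0 < b1" "0 < b2" "b1 \<le> a1" "b2 \<le> a2" "b1 * a2 \<le> b2 * a1"
  shows "bip a1 a2 powr (real b2 / real a2) \<le> bip b1 b2"
proof (rule bip_powr_le_if_le_powr)
  have "real (b1 * a2) \<le> real (b2 * a1)"
    using assms by (simp only: of_nat_le_iff)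
  then have "bip a1 a2 \<le> bip b1 b2 powr (\<Sum>t\<in>{()}. real a2 / real b2)"
    using assms by (intro bip_packing[where p = "\<lambda>_. b1" and q = "\<lambda>_. b2"])
      (auto simp: field_simps)
  then show "bip a1 a2 \<le> bip b1 b2 powr (1 / (real b2 / real a2))"
    by simp
qed (use assms in auto)

text \<open>\<open>K\<^bsub>a1,a2\<^esub>\<close> is fractionally packed by copies of \<open>K\<^bsub>p,b1+b2-p\<^esub>\<close>, where \<open>p\<close> is one of the two integers
  next to \<open>m\<close>, weighted such that the average of \<open>p\<close> is \<open>m\<close>. All of them are at least as balanced as
  \<open>K\<^bsub>b1,b2\<^esub>\<close>.\<close>

lemma bip_ge_more_unbalanced:
  assumes "0 < b2" "b2 \<le> b1" "a2 \<le> a1" "b1 + b2 \<le> a1 + a2" "b2 * a1 \<le> b1 * a2"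
  shows "bip a1 a2 powr (real (b1 + b2) / real (a1 + a2)) \<le> bip b1 b2"
proof (rule bip_powr_le_if_le_powr)
  define r where "r = real (b1 + b2) / real (a1 + a2)"
  \<comment> \<open>With total weight \<open>1 / r\<close>, filling the side \<open>a1\<close>
    exactly forces the average of \<open>p\<close> to be \<open>r * a1\<close>. The average of
    \<open>b1 + b2 - p\<close> is then \<open>r * a2\<close>, so the other side is filled as
    well.\<close>
  define m where "m = r * real a1"
  define \<theta> where "\<theta> = m - of_int \<lfloor>m\<rfloor>"
  \<comment> \<open>\<open>True\<close> selects the floor of \<open>m\<close> and
    \<open>False\<close> the ceiling, the latter with share \<open>\<theta>\<close>. For an integral
    \<open>m\<close> the two agree and \<open>\<theta>\<close> is 0.\<close>
  define p where "p t = nat (if t then \<lfloor>m\<rfloor> else \<lceil>m\<rceil>)" for t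
  define \<alpha> where "\<alpha> t = (if t then 1 - \<theta> else \<theta>) / r" for t
  have "0 < a2"
    using assms by (cases a2) auto
  have r: "0 < r" "r \<le> 1" "r * (real a1 + real a2) = real b1 + real b2"
    using assms \<open>0 < a2\<close> by (auto simp: r_def divide_simps)
  have "m \<le> real a1"
    using r by (simp add: m_def mult_left_le_one_le)
  have "real (b2 * a1) \<le> real (b1 * a2)"
    using assms by (simp only: of_nat_le_iff)
  then have ra2: "real b2 \<le> r * real a2"
    using \<open>0 < a2\<close> by (simp add: r_def field_simps)
  then have "m \<le> real b1"
    using r(3) by (simp add: m_def algebra_simps)
  have "r * real a2 \<le> m"
    using assms r by (simp add: m_def)
  then have "real b2 \<le> m"
    using ra2 by simp
  \<comment> \<open>The product hypothesis reads \<open>b2 \<le> r * a2\<close>. Subtracted from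
    \<open>r * (a1 + a2) = b1 + b2\<close> it gives \<open>m \<le> b1\<close>, and with
    \<open>a2 \<le> a1\<close> it gives \<open>b2 \<le> m\<close>. Rounding preserves these bounds
    since they are integers.\<close>
  then have "int b2 \<le> \<lfloor>m\<rfloor>" "\<lceil>m\<rceil> \<le> int b1" "\<lceil>m\<rceil> \<le> int a1"
    using \<open>m \<le> real a1\<close> \<open>m \<le> real b1\<close> by (auto simp: le_floor_iff ceiling_le_iff)
  then have "int b2 \<le> (if t then \<lfloor>m\<rfloor> else \<lceil>m\<rceil>)" "(if t then \<lfloor>m\<rfloor> else \<lceil>m\<rceil>) \<le> int b1"
    "(if t then \<lfloor>m\<rfloor> else \<lceil>m\<rceil>) \<le> int a1" for t
    using floor_le_ceiling[of m] by presburger+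
  then have p: "b2 \<le> p t" "p t \<le> b1" "p t \<le> a1" for t
    unfolding p_def nat_le_iff by (meson int_nat_eq le_nat_iff nat_int_comparison(3) of_nat_0_le_iff order_trans)+
  have \<theta>: "0 \<le> \<theta>" "\<theta> \<le> 1"
    unfolding \<theta>_def by linarith+
  have "0 \<le> \<lfloor>m\<rfloor>"
    using \<open>int b2 \<le> \<lfloor>m\<rfloor>\<close> by linarith
  then have "(1 - \<theta>) * real (p True) + \<theta> * real (p False) = m"
    using floor_le_ceiling[of m]
    by (cases "m = of_int \<lfloor>m\<rfloor>") (auto simp: p_def \<theta>_def ceiling_altdef algebra_simps)
  then have sum_p: "(\<Sum>t\<in>UNIV. \<alpha> t * real (p t)) = real a1"
    using r by (simp add: UNIV_bool \<alpha>_def m_def add_divide_distrib[symmetric] add.commute)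
  have sum_\<alpha>: "(\<Sum>t\<in>UNIV. \<alpha> t) = 1 / r"
    by (simp add: UNIV_bool \<alpha>_def add_divide_distrib[symmetric])
  have "(\<Sum>t\<in>UNIV. \<alpha> t * real (b1 + b2 - p t))
      = (real b1 + real b2) * (\<Sum>t\<in>UNIV. \<alpha> t) - (\<Sum>t\<in>UNIV. \<alpha> t * real (p t))"
    unfolding sum_distrib_left sum_subtractf[symmetric] using p
    by (intro sum.cong refl) (simp add: of_nat_diff trans_le_add1 algebra_simps)
  also have "\<dots> = real a2"
    unfolding sum_\<alpha> sum_p r(3)[symmetric] using r(1) by simp
  finally have sum_q: "(\<Sum>t\<in>UNIV. \<alpha> t * real (b1 + b2 - p t)) = real a2" .
  have "bip a1 a2 \<le> bip b1 b2 powr (\<Sum>t\<in>UNIV. \<alpha> t)"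
  proof (rule bip_packing[where p = p and q = "\<lambda>t. b1 + b2 - p t"])
    fix t
    \<comment> \<open>Both sides of the packed graph have at least \<open>b2\<close> vertices, so it
      can be unbalanced to sides \<open>b2\<close> and \<open>b1\<close> with the vertex count
      kept.\<close>
    show "bip (p t) (b1 + b2 - p t) \<le> bip b1 b2"
      using bip_unbalance[of b2 "p t" "b1 + b2 - p t"] p[of t] by (simp add: bip_commute)
    show "0 < p t"
      using p(1)[of t] assms by simp
  qed (use p \<theta> r \<open>0 < a2\<close> sum_p sum_q in \<open>auto simp: \<alpha>_def\<close>)
  then show "bip a1 a2 \<le> bip b1 b2 powr (1 / (real (b1 + b2) / real (a1 + a2)))"
    unfolding sum_\<alpha> r_def .
  show "0 < real (b1 + b2) / real (a1 + a2)"
    using r(1) by (simp add: r_def)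
qed

text \<open>Unbalancing all the way, with k = 1, turns K_{a1,a2} into a star with a1+a2-1 leaves.
  Jensen's inequality passes from that star to the one with \<open>b\<close> leaves.\<close>

lemma bip_ge_star:
  assumes "0 < a1" "0 < a2" "a1 + a2 \<le> b + 1"
  shows "bip a1 a2 powr (real b / (real a1 + real a2 - 1)) \<le> bip b 1"
proof -
  have "bip a1 a2 powr (real b / (real a1 + real a2 - 1))
      \<le> bip 1 (a1 + a2 - 1) powr (real b / (real a1 + real a2 - 1))"
    using assms by (intro powr_mono2 bip_unbalance bip_bounds) auto
  also have "\<dots> \<le> bip 1 b"
    using bip_Jensen[of "a1 + a2 - 1" b 1] assms by (simp add: of_nat_diff)
  finally show ?thesis
    by (simp add: bip_commute)
qed

end

subsection \<open>Extremal kernels\<close>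

lemma prod_01:
  fixes f :: "nat \<Rightarrow> real"
  assumes "\<And>i. f i = 0 \<or> f i = 1"
  shows "prod f I = 0 \<or> prod f I = 1"
proof (induction I rule: infinite_finite_induct)
  case (insert i I)
  then show ?case
    using assms[of i] by auto
qed auto

context kernel
begin

lemma integrable_prod_01:
  assumes "finite I" "f \<in> borel_measurable M" "\<And>x. f x = 0 \<or> f x = (1::real)"
  shows "integrable (PM I) (\<lambda>x. \<Prod>i\<in>I. f (x i))"
proof -
  interpret I: prob_space "PM I"
    by (rule prob_space_PM)
  have "(\<lambda>x. f (x i)) \<in> borel_measurable (PM I)" if "i \<in> I" for i
    by (rule measurable_compose[OF measurable_component_singleton[OF that] assms(2)])
  moreover have "0 \<le> (\<Prod>i\<in>I. f (x i))" "(\<Prod>i\<in>I. f (x i)) \<le> 1" for x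
    using prod_01[of "\<lambda>i. f (x i)" I, OF assms(3)] by auto
  ultimately show ?thesis
    by (intro I.integrable_unit_bounded borel_measurable_prod)
qed

lemma bip_constant:
  assumes "\<And>x y. W x y = p"
  shows "bip a b = p ^ (a * b)"
proof -
  have "deg I x = p ^ card I" for I x
    by (simp add: deg_def assms prob_space)
  then show ?thesis
    using prob_space.prob_space[OF prob_space_PM] by (simp add: bip_def power_mult)
qed

context
  fixes h :: "'a \<Rightarrow> real"
  assumes h_borel: "h \<in> borel_measurable M" and h_01: "\<And>x. h x = 0 \<or> h x = 1"
begin

lemma h_bounds: "0 \<le> h x" "h x \<le> 1"
  using h_01[of x] by auto

lemma h_integrable: "integrable M h"
  by (intro integrable_unit_bounded h_borel h_bounds)

text \<open>Here \<open>h\<close> is the indicator of the clique. As both sides are nonempty, every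
  vertex lies on an edge and must be mapped into the clique, independently of the others.\<close>

lemma bip_clique:
  assumes W: "\<And>x y. W x y = h x * h y" and pos: "0 < a" "0 < b"
  shows "bip a b = (\<integral>x. h x \<partial>M) ^ (a + b)"
proof -
  define e where "e = (\<integral>x. h x \<partial>M)"
  have "deg {..<a} x = (\<Prod>i<a. h (x i)) * e" for x
  proof -
    have "(\<Prod>i<a. W (x i) y) = (\<Prod>i<a. h (x i)) * h y" for y
      using h_01[of y] pos(1) by (auto simp: W prod.distrib zero_power)
    then show ?thesis
      by (simp add: deg_def e_def)
  qed
  moreover have "(\<Prod>i<a. h (x i)) ^ b = (\<Prod>i<a. h (x i))" for x
    using prod_01[of "\<lambda>i. h (x i)" "{..<a}", OF h_01] pos(2)
    by (elim disjE) (simp_all only: zero_power power_one)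
  ultimately show ?thesis
    using integral_PM_prod[of "{..<a}" h] h_borel h_bounds
    by (simp add: bip_def power_mult_distrib e_def power_add)
qed

text \<open>K_{a,b} is connected, so all its vertices fall into the same half. Each half contributes
  (1/2)^(a+b), and the factor 2 for the choice of the half removes one from the exponent.\<close>

lemma bip_two_cliques:
  assumes W: "\<And>x y. W x y = h x * h y + (1 - h x) * (1 - h y)"
    and half: "(\<integral>x. h x \<partial>M) = 1 / 2" and pos: "0 < a" "0 < b"
  shows "bip a b = (1 / 2) ^ (a + b - 1)"
proof -
  define A B where "A x = (\<Prod>i<a. h (x i))" and "B x = (\<Prod>i<a. 1 - h (x i))" for x
  have co: "(\<lambda>x. 1 - h x) \<in> borel_measurable M" "1 - h x = 0 \<or> 1 - h x = 1" for x
    using h_borel h_01[of x] by auto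
  have half': "(\<integral>x. 1 - h x \<partial>M) = 1 / 2"
    using h_integrable by (simp add: half prob_space)
  have AB: "A x = 0 \<and> B x = 0 \<or> A x = 1 \<and> B x = 0 \<or> A x = 0 \<and> B x = 1" for x
  proof -
    have "A x = 0 \<or> B x = 0"
      using h_01[of "x 0"] pos(1) by (auto simp: A_def B_def)
    then show ?thesis
      using prod_01[of "\<lambda>i. h (x i)" "{..<a}", OF h_01] prod_01[of "\<lambda>i. 1 - h (x i)" "{..<a}", OF co(2)]
      by (auto simp: A_def B_def)
  qed
  have "deg {..<a} x = A x * (1 / 2) + B x * (1 / 2)" for x
  proof -
    have "(\<Prod>i<a. W (x i) y) = A x * h y + B x * (1 - h y)" for y
      using h_01[of y] by (auto simp: W A_def B_def)
    then show ?thesis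
      using h_integrable by (simp add: deg_def half prob_space)
  qed
  then have "deg {..<a} x ^ b = (1 / 2) ^ b * (A x + B x)" for x
    using AB[of x] pos(2) by (auto simp: zero_power)
  then have "bip a b = (1 / 2) ^ b * (\<integral>x. A x + B x \<partial>PM {..<a})"
    by (simp add: bip_def)
  also have "(\<integral>x. A x + B x \<partial>PM {..<a}) = (1 / 2) ^ a + (1 / 2) ^ a"
    using integral_PM_prod[of "{..<a}" h] integral_PM_prod[of "{..<a}" "\<lambda>x. 1 - h x"]
      integrable_prod_01[OF _ h_borel h_01, of "{..<a}"] integrable_prod_01[OF _ co, of "{..<a}"]
    unfolding A_def B_def
    by (subst Bochner_Integration.integral_add)
      (simp_all add: half half' h_borel h_bounds co(1))
  also have "(1 / 2) ^ b * ((1 / 2) ^ a + (1 / 2) ^ a) = (1 / 2 :: real) ^ (a + b - 1)"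
    using pos(1) by (cases a) (auto simp: power_add)
  finally show ?thesis .
qed

text \<open>An edge is missed only if both ends avoid the hub, so one whole side must lie in the
  hub; inclusion-exclusion over the two sides.\<close>

lemma bip_hub:
  assumes W: "\<And>x y. W x y = max (h x) (h y)" and e: "(\<integral>x. h x \<partial>M) = e" and pos: "0 < a" "0 < b"
  shows "bip a b = e ^ a + e ^ b - e ^ (a + b)"
proof -
  define A where "A x = (\<Prod>i<a. h (x i))" for x
  have A_int: "integrable (PM {..<a}) A"
    unfolding A_def by (intro integrable_prod_01 h_borel h_01) auto
  have "deg {..<a} x = e + (1 - e) * A x" for x
  proof -
    have "(\<Prod>i<a. W (x i) y) = h y + A x * (1 - h y)" for y
      using h_01[of y] by (auto simp: W A_def max_absorb1 max_absorb2 h_bounds)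
    then show ?thesis
      using h_integrable by (simp add: deg_def prob_space e)
  qed
  then have "deg {..<a} x ^ b = e ^ b + (1 - e ^ b) * A x" for x
    using prod_01[of "\<lambda>i. h (x i)" "{..<a}", OF h_01, folded A_def] by auto
  then have "bip a b = (\<integral>x. e ^ b + (1 - e ^ b) * A x \<partial>PM {..<a})"
    by (simp add: bip_def)
  also have "\<dots> = e ^ b + (1 - e ^ b) * (\<integral>x. A x \<partial>PM {..<a})"
    using A_int prob_space.prob_space[OF prob_space_PM]
    by (subst Bochner_Integration.integral_add)
      (simp_all add: finite_measure.integrable_const prob_space.finite_measure prob_space_PM)
  also have "(\<integral>x. A x \<partial>PM {..<a}) = e ^ a"
    using integral_PM_prod[of "{..<a}" h] h_borel h_bounds by (simp add: A_def e)
  finally show ?thesis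
    by (simp add: algebra_simps power_add)
qed

end

end

section \<open>Null sets and completed measures\<close>

lemma integral_completion_cong_AE:
  fixes f g :: "'a \<Rightarrow> real"
  assumes g: "g \<in> borel_measurable M" and eq: "AE x in M. f x = g x"
  shows "(\<integral>x. f x \<partial>completion M) = (\<integral>x. g x \<partial>M)"
proof -
  have eq': "AE x in completion M. f x = g x"
    using eq by (rule AE_completion)
  \<comment> \<open>\<open>f\<close> is not assumed measurable: its preimages differ from those of
    \<open>g\<close> by null sets, which the completion makes measurable.\<close>
  have f: "f \<in> borel_measurable (completion M)"
  proof (rule measurableI)
    fix A :: "real set" assume A: "A \<in> sets borel"
    show "f -` A \<inter> space (completion M) \<in> sets (completion M)"
    proof (rule completion.in_sets_AE)
      show "AE x in completion M. x \<in> g -` A \<inter> space M \<longleftrightarrow> x \<in> f -` A \<inter> space (completion M)"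
        using eq' by eventually_elim simp
      show "g -` A \<inter> space M \<in> sets (completion M)"
        using measurable_sets[OF g A] by simp
    qed simp
  qed simp
  have "(\<integral>x. f x \<partial>completion M) = (\<integral>x. g x \<partial>completion M)"
    using f measurable_completion[OF g] eq' by (rule integral_cong_AE)
  also have "\<dots> = (\<integral>x. g x \<partial>M)"
    using g by (rule integral_completion)
  finally show ?thesis .
qed

text \<open>Distinct coordinates are independent. Hence a null set of the square pulls back to a
  null set of the cube along the pair of coordinates of an edge.\<close>

lemma (in product_prob_space) distr_PiM_two_components:
  assumes K: "finite K" "u \<in> K" "v \<in> K" and "u \<noteq> v"
  shows "distr (PiM K M) (M u \<Otimes>\<^sub>M M v) (\<lambda>x. (x u, x v)) = M u \<Otimes>\<^sub>M M v"
proof (rule pair_measure_eqI[symmetric])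
  have meas: "(\<lambda>x. (x u, x v)) \<in> PiM K M \<rightarrow>\<^sub>M M u \<Otimes>\<^sub>M M v"
    using K by (intro measurable_Pair measurable_component_singleton)
  fix A B assume AB: "A \<in> sets (M u)" "B \<in> sets (M v)"
  define C where "C i = (if i = u then A else if i = v then B else space (M i))" for i
  have "(\<lambda>x. (x u, x v)) -` (A \<times> B) \<inter> space (PiM K M) = Pi\<^sub>E K C"
  proof (intro set_eqI iffI)
    fix x assume "x \<in> (\<lambda>x. (x u, x v)) -` (A \<times> B) \<inter> space (PiM K M)"
    then show "x \<in> Pi\<^sub>E K C"
      by (auto simp: C_def space_PiM PiE_iff)
  next
    fix x assume x: "x \<in> Pi\<^sub>E K C"
    have "x u \<in> A" "x v \<in> B"
      using PiE_mem[OF x, of u] PiE_mem[OF x, of v] K \<open>u \<noteq> v\<close> by (auto simp: C_def)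
    moreover have "x i \<in> space (M i)" if "i \<in> K" for i
      using PiE_mem[OF x that] sets.sets_into_space[OF AB(1)] sets.sets_into_space[OF AB(2)]
      by (auto simp: C_def split: if_splits)
    moreover have "x \<in> extensional K"
      using x by (simp add: PiE_iff)
    ultimately show "x \<in> (\<lambda>x. (x u, x v)) -` (A \<times> B) \<inter> space (PiM K M)"
      by (simp add: space_PiM PiE_iff)
  qed
  then have "emeasure (distr (PiM K M) (M u \<Otimes>\<^sub>M M v) (\<lambda>x. (x u, x v))) (A \<times> B)
      = emeasure (PiM K M) (Pi\<^sub>E K C)"
    using meas AB by (simp add: emeasure_distr)
  also have "\<dots> = (\<Prod>i\<in>K. emeasure (M i) (C i))"
    using K AB by (intro emeasure_PiM) (auto simp: C_def)
  also have "\<dots> = (\<Prod>i\<in>{u, v}. emeasure (M i) (C i))"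
    using K by (intro prod.mono_neutral_right) (auto simp: C_def M.emeasure_space_1)
  also have "\<dots> = emeasure (M u) A * emeasure (M v) B"
    using \<open>u \<noteq> v\<close> by (simp add: C_def)
  finally show "emeasure (M u) A * emeasure (M v) B
      = emeasure (distr (PiM K M) (M u \<Otimes>\<^sub>M M v) (\<lambda>x. (x u, x v))) (A \<times> B)" ..
qed (simp_all add: M.sigma_finite_measure_axioms)

subsection \<open>Graphons\<close>

abbreviation unit_measure :: "real measure" where
  "unit_measure \<equiv> restrict_space lborel {0..1}"

lemma prob_space_unit_measure: "prob_space unit_measure"
  by (intro prob_space_restrict_space) auto

lemma measurable_unit_square_inclusion:
  "(\<lambda>z. z) \<in> unit_measure \<Otimes>\<^sub>M unit_measure \<rightarrow>\<^sub>M borel \<Otimes>\<^sub>M borel"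
proof -
  have "(\<lambda>z. (fst z, snd z)) \<in> unit_measure \<Otimes>\<^sub>M unit_measure \<rightarrow>\<^sub>M borel \<Otimes>\<^sub>M borel"
    by (intro measurable_Pair measurable_compose[OF measurable_fst] measurable_compose[OF measurable_snd]
        measurable_restrict_space1) (auto simp: measurable_ident_sets)
  then show ?thesis
    by simp
qed

lemma kernel_unit_measureI:
  assumes "case_prod W \<in> borel_measurable (borel \<Otimes>\<^sub>M borel)"
    and "\<And>x y. W x y = W y x" "\<And>x y. 0 \<le> W x y" "\<And>x y. W x y \<le> 1"
  shows "kernel unit_measure W"
  using assms measurable_compose[OF measurable_unit_square_inclusion assms(1)] prob_space_unit_measure
  by (intro kernel.intro kernel_axioms.intro) auto

lemma graphon_if_borel:
  assumes "case_prod W \<in> borel_measurable (borel \<Otimes>\<^sub>M borel)"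
    and "\<And>x y. W x y = W y x" "\<And>x y. 0 \<le> W x y" "\<And>x y. W x y \<le> 1"
  shows "graphon W"
proof -
  have "case_prod W \<in> borel_measurable lborel"
    using assms(1) by (simp add: borel_prod)
  then have "case_prod W \<in> borel_measurable (lebesgue_on ({0..1} \<times> {0..1}))"
    by (intro measurable_restrict_space1 measurable_completion)
  then show ?thesis
    using assms(2-) by (simp add: graphon_def)
qed

text \<open>The first side carries the smaller labels, so \<open>u < v\<close> orients every edge
  from the first side to the second.\<close>

lemma edges_complete_bipartite:
  "{(u, v). u < v \<and> {u, v} \<in> edges (complete_bipartite a b)} = {..<a} \<times> {a..<a + b}"
  by (fastforce simp: complete_bipartite_def doubleton_eq_iff)

text \<open>Agreement is asked for distinct indices only: the integrand never evaluates
  \<open>W\<close> at (x u, x u), and on the diagonal, a null set of the square, nothing is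
  known.\<close>

lemma hom_density_kernel_AE:
  assumes "kernel unit_measure V"
    and eq: "AE x in PiM {..<a + b} (\<lambda>_. unit_measure).
      \<forall>u\<in>{..<a + b}. \<forall>v\<in>{..<a + b}. u \<noteq> v \<longrightarrow> W (x u) (x v) = V (x u) (x v)"
  shows "hom_density (complete_bipartite a b) W = kernel.bip unit_measure V a b"
proof -
  interpret kernel unit_measure V
    by fact
  have un: "{..<a + b} = {..<a} \<union> {a..<a + b}"
    by auto
  define F where "F x = (\<Prod>u\<in>{..<a}. \<Prod>v\<in>{a..<a + b}. V (x u) (x v))" for x
  interpret I: prob_space "PM {..<a + b}"
    by (rule prob_space_PM)
  have F_meas: "F \<in> borel_measurable (PM {..<a + b})"
    unfolding F_def
    by (intro borel_measurable_prod measurable_W measurable_component_singleton) auto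
  have F_int: "integrable (PM {..<a + b}) F"
    using F_meas unfolding F_def by (intro I.integrable_unit_bounded prod2_W_bounds) auto
  have "hom_density (complete_bipartite a b) W
      = (\<integral>x. (\<Prod>(u, v)\<in>{..<a} \<times> {a..<a + b}. W (x u) (x v)) \<partial>completion (PM {..<a + b}))"
    unfolding hom_density_def edges_complete_bipartite by (simp add: complete_bipartite_def)
  also have "\<dots> = (\<integral>x. F x \<partial>PM {..<a + b})"
  proof (rule integral_completion_cong_AE[OF F_meas])
    show "AE x in PM {..<a + b}. (\<Prod>(u, v)\<in>{..<a} \<times> {a..<a + b}. W (x u) (x v)) = F x"
      using eq
    proof eventually_elim
      case (elim x)
      then show ?case
        unfolding F_def prod.cartesian_product by (intro prod.cong) auto
    qed
  qed
  also have "\<dots> = (\<integral>x. (\<integral>y. F (merge {..<a} {a..<a + b} (x, y)) \<partial>PM {a..<a + b}) \<partial>PM {..<a})"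
    using F_int unfolding un by (intro P.product_integral_fold) auto
  also have "\<dots> = (\<integral>x. deg {..<a} x ^ b \<partial>PM {..<a})"
  proof (rule Bochner_Integration.integral_cong[OF refl])
    fix x assume x: "x \<in> space (PM {..<a})"
    have "F (merge {..<a} {a..<a + b} (x, y)) = (\<Prod>u\<in>{..<a}. \<Prod>v\<in>{a..<a + b}. V (x u) (y v))" for y
      unfolding F_def by (intro prod.cong refl) (auto simp: merge_def)
    then show "(\<integral>y. F (merge {..<a} {a..<a + b} (x, y)) \<partial>PM {a..<a + b}) = deg {..<a} x ^ b"
      using deg_power_eq_integral[OF x order_refl, of "{a..<a + b}"] by simp
  qed
  finally show ?thesis
    by (simp add: bip_def)
qed

lemma hom_density_kernel:
  assumes "kernel unit_measure W"
  shows "hom_density (complete_bipartite a b) W = kernel.bip unit_measure W a b"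
  using assms by (rule hom_density_kernel_AE) simp

text \<open>A null set of the plane is compared slice by slice: over points of the interval, each
  slice has no larger measure for \<open>unit_measure\<close> than for
  \<open>lborel\<close>.\<close>

lemma AE_unit_square_if_lborel:
  assumes "AE z in lborel. P (z :: real \<times> real)"
  shows "AE z in unit_measure \<Otimes>\<^sub>M unit_measure. P z"
proof -
  interpret U: prob_space unit_measure
    by (rule prob_space_unit_measure)
  obtain N where N: "N \<in> sets lborel" "emeasure lborel N = 0" "{z. \<not> P z} \<subseteq> N"
    using assms by (auto elim!: AE_E)
  have N': "N \<in> sets (lborel \<Otimes>\<^sub>M lborel)"
    unfolding lborel_prod by (rule N(1))
  define N1 where "N1 = N \<inter> space (unit_measure \<Otimes>\<^sub>M unit_measure)"
  have "N \<in> sets (borel \<Otimes>\<^sub>M borel)"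
    using N(1) unfolding borel_prod sets_lborel .
  from measurable_sets[OF measurable_unit_square_inclusion this]
  have N1: "N1 \<in> sets (unit_measure \<Otimes>\<^sub>M unit_measure)"
    by (simp add: N1_def)
  have "emeasure (unit_measure \<Otimes>\<^sub>M unit_measure) N1
      = (\<integral>\<^sup>+x. emeasure unit_measure (Pair x -` N1) \<partial>unit_measure)"
    using N1 by (rule U.emeasure_pair_measure_alt)
  also have "\<dots> \<le> (\<integral>\<^sup>+x. emeasure lborel (Pair x -` N) \<partial>unit_measure)"
  proof (rule nn_integral_mono)
    fix x assume x: "x \<in> space unit_measure"
    have "emeasure unit_measure (Pair x -` N1) = emeasure lborel (Pair x -` N1)"
      by (intro emeasure_restrict_space) (auto simp: N1_def space_pair_measure)
    also have "\<dots> \<le> emeasure lborel (Pair x -` N)"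
      using N' by (intro emeasure_mono sets_Pair1) (auto simp: N1_def)
    finally show "emeasure unit_measure (Pair x -` N1) \<le> emeasure lborel (Pair x -` N)" .
  qed
  also have "\<dots> = (\<integral>\<^sup>+x. emeasure lborel (Pair x -` N) * indicator {0..1} x \<partial>lborel)"
    by (intro nn_integral_restrict_space) auto
  also have "\<dots> \<le> (\<integral>\<^sup>+x. emeasure lborel (Pair x -` N) \<partial>lborel)"
    by (intro nn_integral_mono) (auto simp: indicator_def)
  also have "\<dots> = emeasure (lborel \<Otimes>\<^sub>M lborel) N"
    using N' by (rule lborel.emeasure_pair_measure_alt[symmetric])
  also have "\<dots> = 0"
    using N(2) by (simp add: lborel_prod)
  finally have "N1 \<in> null_sets (unit_measure \<Otimes>\<^sub>M unit_measure)"
    using N1 by (auto simp: null_sets_def)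
  moreover have "{z \<in> space (unit_measure \<Otimes>\<^sub>M unit_measure). \<not> P z} \<subseteq> N1"
    using N(3) by (auto simp: N1_def)
  ultimately show ?thesis
    by (rule AE_I')
qed

lemma graphon_eq_kernel:
  assumes "graphon W"
  obtains V where "kernel unit_measure V"
    "\<And>a b. hom_density (complete_bipartite a b) W = kernel.bip unit_measure V a b"
proof -
  define Q where "Q = {0..1::real} \<times> {0..1::real}"
  have W: "case_prod W \<in> borel_measurable (lebesgue_on Q)"
    "\<And>x y. x \<in> {0..1} \<Longrightarrow> y \<in> {0..1} \<Longrightarrow> W x y = W y x \<and> 0 \<le> W x y \<and> W x y \<le> 1"
    using assms by (auto simp: graphon_def Q_def)
  have "Q \<in> sets borel"
    unfolding Q_def by (intro borel_closed closed_Times) auto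
  then have "(\<lambda>z. indicator Q z *\<^sub>R case_prod W z) \<in> borel_measurable lebesgue"
    using W(1) by (subst (asm) borel_measurable_restrict_space_iff) auto
  from completion_ex_borel_measurable_real[OF this] obtain g where
    g: "g \<in> borel_measurable lborel" "AE z in lborel. indicator Q z *\<^sub>R case_prod W z = g z"
    by blast
  \<comment> \<open>A Borel version \<open>g\<close> has the properties of a graphon only almost
    everywhere. Symmetrising and clipping enforce them everywhere, and change nothing where
    \<open>g\<close> agrees with \<open>W\<close> at both (x, y) and (y, x).\<close>
  define V where "V x y = max 0 (min 1 ((g (x, y) + g (y, x)) / 2))" for x y
  have gm: "g \<in> borel_measurable (borel \<Otimes>\<^sub>M borel)"
    using g(1) by (simp add: borel_prod)
  have gm': "(\<lambda>z. g (snd z, fst z)) \<in> borel_measurable (borel \<Otimes>\<^sub>M borel)"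
    by (rule measurable_compose[OF _ gm]) (intro measurable_Pair measurable_fst measurable_snd)
  have "kernel unit_measure V"
  proof (rule kernel_unit_measureI)
    show "case_prod V \<in> borel_measurable (borel \<Otimes>\<^sub>M borel)"
      using gm gm' unfolding V_def by (simp add: case_prod_beta')
  qed (auto simp: V_def add.commute)
  moreover have "hom_density (complete_bipartite a b) W = kernel.bip unit_measure V a b" for a b
  proof (rule hom_density_kernel_AE)
    let ?PM = "PiM {..<a + b} (\<lambda>_. unit_measure)"
    interpret product_prob_space "\<lambda>_. unit_measure" "{..<a + b}"
      using prob_space_unit_measure
      by (simp add: product_prob_space_def product_prob_space_axioms_def product_sigma_finite_def
          prob_space_imp_sigma_finite)
    have uv: "AE x in ?PM. W (x u) (x v) = g (x u, x v)"
      if "u < a + b" "v < a + b" "u \<noteq> v" for u v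
    proof -
      have meas: "(\<lambda>x. (x u, x v)) \<in> ?PM \<rightarrow>\<^sub>M unit_measure \<Otimes>\<^sub>M unit_measure"
        using that by (intro measurable_Pair measurable_component_singleton) auto
      have distr: "distr ?PM (unit_measure \<Otimes>\<^sub>M unit_measure) (\<lambda>x. (x u, x v))
          = unit_measure \<Otimes>\<^sub>M unit_measure"
        using that by (intro distr_PiM_two_components) auto
      have "AE z in distr ?PM (unit_measure \<Otimes>\<^sub>M unit_measure) (\<lambda>x. (x u, x v)).
          indicator Q z *\<^sub>R case_prod W z = g z"
        unfolding distr using g(2) by (rule AE_unit_square_if_lborel)
      then have "AE x in ?PM. indicator Q (x u, x v) *\<^sub>R case_prod W (x u, x v) = g (x u, x v)"
        by (rule AE_distrD[OF meas])
      moreover have "AE x in ?PM. (x u, x v) \<in> Q"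
        using that by (intro AE_I2) (auto simp: Q_def space_PiM PiE_iff space_restrict_space)
      ultimately show ?thesis
        by eventually_elim simp
    qed
    have "AE x in ?PM. \<forall>u\<in>{..<a + b}. \<forall>v\<in>{..<a + b}. u \<noteq> v \<longrightarrow> W (x u) (x v) = g (x u, x v)"
      using uv by (simp add: AE_finite_all)
    moreover have "AE x in ?PM. \<forall>u\<in>{..<a + b}. x u \<in> {0..1}"
      by (intro AE_I2) (auto simp: space_PiM PiE_iff space_restrict_space)
    ultimately show "AE x in ?PM. \<forall>u\<in>{..<a + b}. \<forall>v\<in>{..<a + b}. u \<noteq> v \<longrightarrow> W (x u) (x v) = V (x u) (x v)"
    proof eventually_elim
      case (elim x)
      show ?case
      proof (intro ballI impI)
        fix u v assume uv: "u \<in> {..<a + b}" "v \<in> {..<a + b}" "u \<noteq> v"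
        then have "g (x u, x v) = W (x u) (x v)" "g (x v, x u) = W (x v) (x u)"
          using elim(1) by auto
        moreover have "W (x v) (x u) = W (x u) (x v)" "0 \<le> W (x u) (x v)" "W (x u) (x v) \<le> 1"
          using W(2) elim(2) uv by blast+
        ultimately show "W (x u) (x v) = V (x u) (x v)"
          by (simp add: V_def)
      qed
    qed
  qed fact
  ultimately show thesis
    by (rule that)
qed

subsection \<open>The domination exponent\<close>

lemma domination_exponent_le:
  assumes bound: "\<And>V. kernel unit_measure V \<Longrightarrow>
      kernel.bip unit_measure V a1 a2 powr c \<le> kernel.bip unit_measure V b1 b2"
    and "0 \<le> c"
  shows "domination_exponent (complete_bipartite a1 a2) (complete_bipartite b1 b2) \<le> ennreal c"
  unfolding domination_exponent_def
proof (rule SUP_least)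
  fix W assume W: "W \<in> {W. graphon W \<and> hom_density (complete_bipartite a1 a2) W \<noteq> 0 \<and>
      hom_density (complete_bipartite a1 a2) W \<noteq> 1}"
  then obtain V where V: "kernel unit_measure V"
    "\<And>a b. hom_density (complete_bipartite a b) W = kernel.bip unit_measure V a b"
    using graphon_eq_kernel[of W] by auto
  interpret kernel unit_measure V
    by (rule V(1))
  have t: "0 < bip a1 a2" "bip a1 a2 < 1"
    using W bip_bounds[of a1 a2] by (auto simp: V(2))
  then have "0 < bip a1 a2 powr c"
    by simp
  \<comment> \<open>This excludes the infinite branch of the supremum.\<close>
  then have s: "0 < bip b1 b2"
    using bound[OF V(1)] by (rule less_le_trans)
  have "ln (bip a1 a2 powr c) \<le> ln (bip b1 b2)"
    using \<open>0 < bip a1 a2 powr c\<close> s bound[OF V(1)] by (simp only: ln_le_cancel_iff)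
  then have "c * ln (bip a1 a2) \<le> ln (bip b1 b2)"
    using t by (simp add: ln_powr)
  moreover have "ln (bip a1 a2) < 0"
    using t by simp
  ultimately have "ln (bip b1 b2) / ln (bip a1 a2) \<le> c"
    by (simp add: divide_le_eq)
  then show "(if hom_density (complete_bipartite b1 b2) W = 0 then \<infinity>
      else ennreal (ln (hom_density (complete_bipartite b1 b2) W) /
        ln (hom_density (complete_bipartite a1 a2) W))) \<le> ennreal c"
    using s by (simp add: V(2) ennreal_leI)
qed

section \<open>Lower bounds from explicit graphons\<close>

lemma le_domination_exponent:
  assumes V: "case_prod V \<in> borel_measurable (borel \<Otimes>\<^sub>M borel)"
      "\<And>x y. V x y = V y x" "\<And>x y. 0 \<le> V x y" "\<And>x y. V x y \<le> 1"
    and t: "0 < kernel.bip unit_measure V a1 a2" "kernel.bip unit_measure V a1 a2 < 1"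
  shows "ennreal (ln (kernel.bip unit_measure V b1 b2) / ln (kernel.bip unit_measure V a1 a2))
    \<le> domination_exponent (complete_bipartite a1 a2) (complete_bipartite b1 b2)"
proof -
  note hd = hom_density_kernel[OF kernel_unit_measureI[OF V]]
  have "V \<in> {W. graphon W \<and> hom_density (complete_bipartite a1 a2) W \<noteq> 0 \<and>
      hom_density (complete_bipartite a1 a2) W \<noteq> 1}"
    using t graphon_if_borel[OF V] by (simp add: hd)
  then show ?thesis
    unfolding domination_exponent_def by (rule SUP_upper2) (simp add: hd)
qed

text \<open>Logarithms of powers of 1/2 reduce the quotient to a ratio of counts: edges for the
  constant graphon, vertices for one clique, vertices minus one for two cliques.\<close>

lemma le_domination_exponent_powers:
  assumes V: "case_prod V \<in> borel_measurable (borel \<Otimes>\<^sub>M borel)"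
      "\<And>x y. V x y = V y x" "\<And>x y. 0 \<le> V x y" "\<And>x y. V x y \<le> 1"
    and t: "kernel.bip unit_measure V a1 a2 = (1 / 2) ^ m" "0 < m"
    and s: "kernel.bip unit_measure V b1 b2 = (1 / 2) ^ n"
  shows "ennreal (real n / real m)
    \<le> domination_exponent (complete_bipartite a1 a2) (complete_bipartite b1 b2)"
proof -
  have "0 < (1 / 2 :: real) ^ m" "(1 / 2 :: real) ^ m < 1"
    using t(2) by (auto intro: power_Suc_less_one simp: power_less_one_iff)
  then have "ennreal (ln ((1 / 2) ^ n) / ln ((1 / 2) ^ m))
      \<le> domination_exponent (complete_bipartite a1 a2) (complete_bipartite b1 b2)"
    using le_domination_exponent[OF V, of a1 a2 b1 b2] by (simp only: t(1) s)
  moreover have "ln ((1 / 2) ^ n) / ln ((1 / 2) ^ m) = real n / real m"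
    by (simp add: ln_realpow)
  ultimately show ?thesis
    by (simp only:)
qed

lemma integral_unit_measure_indicator:
  assumes "0 \<le> e" "e \<le> 1"
  shows "(\<integral>x. indicator {0..e} x \<partial>unit_measure) = e"
proof -
  have "(\<integral>x. indicator {0..e} x \<partial>unit_measure) = measure unit_measure ({0..e} \<inter> {0..1})"
    by (simp add: space_restrict_space)
  also have "{0..e} \<inter> {0..1} = {0..e}"
    using assms by auto
  also have "measure unit_measure {0..e} = measure lborel {0..e}"
    using assms by (intro measure_restrict_space) auto
  finally show ?thesis
    using assms by simp
qed

lemma borel_measurable_unit_measureI:
  "f \<in> borel_measurable borel \<Longrightarrow> f \<in> borel_measurable unit_measure"
  by (rule measurable_restrict_space1) simp

lemma le_domination_exponent_constant:
  assumes "0 < a1" "0 < a2"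
  shows "ennreal (real (b1 * b2) / real (a1 * a2))
    \<le> domination_exponent (complete_bipartite a1 a2) (complete_bipartite b1 b2)"
proof (rule le_domination_exponent_powers)
  interpret kernel unit_measure "\<lambda>_ _. 1 / 2"
    by (rule kernel_unit_measureI) auto
  show "bip a1 a2 = (1 / 2) ^ (a1 * a2)" "bip b1 b2 = (1 / 2) ^ (b1 * b2)"
    by (rule bip_constant, rule refl)+
qed (use assms in auto)

lemma le_domination_exponent_clique:
  assumes "0 < a1" "0 < a2" "0 < b1" "0 < b2"
  shows "ennreal (real (b1 + b2) / real (a1 + a2))
    \<le> domination_exponent (complete_bipartite a1 a2) (complete_bipartite b1 b2)"
proof (rule le_domination_exponent_powers)
  define h :: "real \<Rightarrow> real" where "h = indicator {0..1 / 2}"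
  define V where "V x y = h x * h y" for x y
  have h: "h \<in> borel_measurable borel" "h x = 0 \<or> h x = 1" for x
    by (auto simp: h_def indicator_def)
  show V: "case_prod V \<in> borel_measurable (borel \<Otimes>\<^sub>M borel)"
    "V x y = V y x" "0 \<le> V x y" "V x y \<le> 1" for x y
    using h(1) h(2)[of x] h(2)[of y]
    by (auto simp: V_def case_prod_beta' mult.commute)
  interpret kernel unit_measure V
    by (rule kernel_unit_measureI[OF V])
  have half: "(\<integral>x. h x \<partial>unit_measure) = 1 / 2"
    unfolding h_def by (rule integral_unit_measure_indicator) auto
  have "bip a b = (1 / 2) ^ (a + b)" if "0 < a" "0 < b" for a b
    using bip_clique[OF borel_measurable_unit_measureI[OF h(1)] h(2) V_def that]
    unfolding half .
  then show "bip a1 a2 = (1 / 2) ^ (a1 + a2)" "bip b1 b2 = (1 / 2) ^ (b1 + b2)"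
    using assms by auto
qed (use assms in auto)

lemma le_domination_exponent_two_cliques:
  assumes "0 < a1" "0 < a2" "0 < b1" "0 < b2"
  shows "ennreal (real (b1 + b2 - 1) / real (a1 + a2 - 1))
    \<le> domination_exponent (complete_bipartite a1 a2) (complete_bipartite b1 b2)"
proof (rule le_domination_exponent_powers)
  define h :: "real \<Rightarrow> real" where "h = indicator {0..1 / 2}"
  define V where "V x y = h x * h y + (1 - h x) * (1 - h y)" for x y
  have h: "h \<in> borel_measurable borel" "h x = 0 \<or> h x = 1" for x
    by (auto simp: h_def indicator_def)
  show V: "case_prod V \<in> borel_measurable (borel \<Otimes>\<^sub>M borel)"
    "V x y = V y x" "0 \<le> V x y" "V x y \<le> 1" for x y
    using h(1) h(2)[of x] h(2)[of y]
    by (auto simp: V_def case_prod_beta' mult.commute)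
  interpret kernel unit_measure V
    by (rule kernel_unit_measureI[OF V])
  have half: "(\<integral>x. h x \<partial>unit_measure) = 1 / 2"
    unfolding h_def by (rule integral_unit_measure_indicator) auto
  have "bip a b = (1 / 2) ^ (a + b - 1)" if "0 < a" "0 < b" for a b
    by (rule bip_two_cliques[OF borel_measurable_unit_measureI[OF h(1)] h(2) V_def half that])
  then show "bip a1 a2 = (1 / 2) ^ (a1 + a2 - 1)" "bip b1 b2 = (1 / 2) ^ (b1 + b2 - 1)"
    using assms by auto
qed (use assms in auto)

text \<open>For a hub of measure e = 2^(-n), placing the smaller side in the hub dominates: the two
  densities are at least e^a2 and at most 2 * e^b2. The factor 2 costs the error term, which
  vanishes as \<open>n\<close> grows and the hub shrinks.\<close>

lemma le_domination_exponent_hub_aux: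
  assumes pos: "0 < a2" "a2 \<le> a1" "0 < b2" "b2 \<le> b1" and n: "0 < n"
  shows "ennreal (real b2 / real a2 - 1 / (real a2 * real n))
    \<le> domination_exponent (complete_bipartite a1 a2) (complete_bipartite b1 b2)"
proof -
  define e where "e = (1 / 2 :: real) ^ n"
  define h :: "real \<Rightarrow> real" where "h = indicator {0..e}"
  define V where "V x y = max (h x) (h y)" for x y
  have e: "0 < e" "e < 1"
    using n by (auto simp: e_def power_less_one_iff)
  have h: "h \<in> borel_measurable borel" "h x = 0 \<or> h x = 1" for x
    by (auto simp: h_def indicator_def)
  have V: "case_prod V \<in> borel_measurable (borel \<Otimes>\<^sub>M borel)"
    "V x y = V y x" "0 \<le> V x y" "V x y \<le> 1" for x y
    using h(1) h(2)[of x] h(2)[of y]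
    by (auto simp: V_def case_prod_beta' max.commute)
  interpret kernel unit_measure V
    by (rule kernel_unit_measureI[OF V])
  have bip: "bip a b = e ^ a + e ^ b - e ^ (a + b)" if "0 < a" "0 < b" for a b
  proof (rule bip_hub[OF borel_measurable_unit_measureI[OF h(1)] h(2) V_def _ that])
    show "(\<integral>x. h x \<partial>unit_measure) = e"
      unfolding h_def using e by (intro integral_unit_measure_indicator) auto
  qed
  have e_pow: "0 < e ^ k" for k
    using e by simp
  have "e ^ (a1 + a2) \<le> e ^ a1"
    using e by (intro power_decreasing) auto
  then have t_ge: "e ^ a2 \<le> bip a1 a2"
    using pos by (simp add: bip)
  then have t_pos: "0 < bip a1 a2"
    using e_pow[of a2] by linarith
  have "bip a1 a2 = 1 - (1 - e ^ a1) * (1 - e ^ a2)"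
    using pos by (simp add: bip power_add algebra_simps)
  moreover have "0 < (1 - e ^ a1) * (1 - e ^ a2)"
    using pos e by (intro mult_pos_pos) (auto simp: power_less_one_iff)
  ultimately have t_less: "bip a1 a2 < 1"
    by simp
  have "e ^ b1 \<le> e ^ b2"
    using e pos by (intro power_decreasing) auto
  then have s_le: "bip b1 b2 \<le> 2 * e ^ b2"
    using pos e_pow[of "b1 + b2"] by (simp add: bip)
  have "e ^ (b1 + b2) \<le> e ^ b1"
    using e by (intro power_decreasing) auto
  then have s_pos: "0 < bip b1 b2"
    using pos e_pow[of b2] by (simp add: bip)
  have ln_e: "ln (e ^ k) = - (real k * real n * ln 2)" for k
    by (simp add: e_def ln_realpow ln_div)
  have "ln (bip b1 b2) \<le> ln (2 * e ^ b2)"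
    using s_pos s_le by simp
  also have "\<dots> = - ((real b2 * real n - 1) * ln 2)"
    using e by (simp add: ln_mult ln_e algebra_simps)
  finally have s: "(real b2 * real n - 1) * ln 2 \<le> - ln (bip b1 b2)"
    by simp
  have "ln (e ^ a2) \<le> ln (bip a1 a2)"
    using t_ge t_pos e_pow[of a2] by (simp only: ln_le_cancel_iff)
  then have t: "- ln (bip a1 a2) \<le> real a2 * real n * ln 2"
    by (simp add: ln_e)
  have "1 \<le> b2 * n"
    using pos n by simp
  then have "1 \<le> real b2 * real n"
    by (metis of_nat_1 of_nat_le_iff of_nat_mult)
  then have "((real b2 * real n - 1) * ln 2) / (real a2 * real n * ln 2)
      \<le> (- ln (bip b1 b2)) / (- ln (bip a1 a2))"
    using s t t_pos t_less s_pos bip_bounds(2)[of b1 b2] by (intro frac_le) auto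
  also have "((real b2 * real n - 1) * ln 2) / (real a2 * real n * ln 2)
      = real b2 / real a2 - 1 / (real a2 * real n)"
    using pos n by (simp add: field_simps)
  finally have "ennreal (real b2 / real a2 - 1 / (real a2 * real n))
      \<le> ennreal (ln (bip b1 b2) / ln (bip a1 a2))"
    by (intro ennreal_leI) simp
  also have "\<dots> \<le> domination_exponent (complete_bipartite a1 a2) (complete_bipartite b1 b2)"
    by (rule le_domination_exponent[OF V t_pos t_less])
  finally show ?thesis .
qed

lemma le_domination_exponent_hub:
  assumes "0 < a2" "a2 \<le> a1" "0 < b2" "b2 \<le> b1"
  shows "ennreal (real b2 / real a2)
    \<le> domination_exponent (complete_bipartite a1 a2) (complete_bipartite b1 b2)"
proof (rule LIMSEQ_le_const2)
  have "(\<lambda>n. real b2 / real a2 - 1 / real a2 * (1 / real n)) \<longlonglongrightarrow> real b2 / real a2 - 1 / real a2 * 0"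
    by (intro tendsto_intros lim_1_over_n)
  then show "(\<lambda>n. ennreal (real b2 / real a2 - 1 / (real a2 * real n))) \<longlonglongrightarrow> ennreal (real b2 / real a2)"
    by (intro tendsto_ennrealI) simp
  show "\<exists>N. \<forall>n\<ge>N. ennreal (real b2 / real a2 - 1 / (real a2 * real n))
      \<le> domination_exponent (complete_bipartite a1 a2) (complete_bipartite b1 b2)"
    using le_domination_exponent_hub_aux[OF assms] by (intro exI[of _ 1]) auto
qed

theorem theorem5p3:
  fixes a1 a2 b1 b2 :: nat
  assumes "0 < a2" and "a2 \<le> a1" and "0 < b2" and "b2 \<le> b1"
  shows "(b1 \<ge> a1 \<and> b2 \<ge> a2 \<longrightarrow>
            domination_exponent (complete_bipartite a1 a2) (complete_bipartite b1 b2)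
              = ennreal (real (b1 * b2) / real (a1 * a2))) \<and>
         (b1 \<le> a1 \<and> b2 \<ge> a2 \<longrightarrow>
            domination_exponent (complete_bipartite a1 a2) (complete_bipartite b1 b2)
              = ennreal (real b2 / real a2)) \<and>
         (b1 \<le> a1 \<and> b2 \<le> a2 \<longrightarrow>
            domination_exponent (complete_bipartite a1 a2) (complete_bipartite b1 b2)
              = ennreal (max (real b2 / real a2) (real (b1 + b2) / real (a1 + a2)))) \<and>
         (b1 \<ge> a1 \<and> b2 \<le> a2 \<and> b1 + b2 \<le> a1 + a2 \<longrightarrow>
            domination_exponent (complete_bipartite a1 a2) (complete_bipartite b1 b2)
              = ennreal (real (b1 + b2) / real (a1 + a2))) \<and>
         (b1 \<ge> a1 \<and> b2 = 1 \<and> b1 + b2 \<ge> a1 + a2 \<longrightarrow>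
            domination_exponent (complete_bipartite a1 a2) (complete_bipartite b1 b2)
              = ennreal (real b1 / (real a1 + real a2 - 1)))"
proof (intro conjI impI; (elim conjE)?)
  have pos: "0 < a1" "0 < a2" "0 < b1" "0 < b2"
    using assms by auto
  note const_half = le_domination_exponent_constant[OF pos(1,2), of b1 b2]
  note clique = le_domination_exponent_clique[OF pos]
  note two_cliques = le_domination_exponent_two_cliques[OF pos]
  note hub = le_domination_exponent_hub[OF assms]
  let ?\<rho> = "domination_exponent (complete_bipartite a1 a2) (complete_bipartite b1 b2)"
  show "?\<rho> = ennreal (real (b1 * b2) / real (a1 * a2))" if "a1 \<le> b1" "a2 \<le> b2"
    using that pos
    by (intro antisym domination_exponent_le const_half kernel.bip_ge_both_larger) auto
  show "?\<rho> = ennreal (real b2 / real a2)" if "b1 \<le> a1" "a2 \<le> b2"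
    using that pos
    by (intro antisym domination_exponent_le hub kernel.bip_ge_second_larger) auto
  show "?\<rho> = ennreal (max (real b2 / real a2) (real (b1 + b2) / real (a1 + a2)))"
    if "b1 \<le> a1" "b2 \<le> a2"
  proof (rule antisym)
    show "ennreal (max (real b2 / real a2) (real (b1 + b2) / real (a1 + a2))) \<le> ?\<rho>"
      using clique hub by (simp add: max_def)
    show "?\<rho> \<le> ennreal (max (real b2 / real a2) (real (b1 + b2) / real (a1 + a2)))"
    \<comment> \<open>After clearing denominators, this condition says that the first term of the
      maximum is the larger one.\<close>
    proof (cases "b1 * a2 \<le> b2 * a1")
      case True
      then have "?\<rho> \<le> ennreal (real b2 / real a2)"
        using that pos by (intro domination_exponent_le kernel.bip_ge_both_smaller) auto
      then show ?thesis
        by (rule order_trans) (intro ennreal_leI max.cobounded1)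
    next
      case False
      then have "?\<rho> \<le> ennreal (real (b1 + b2) / real (a1 + a2))"
        using that assms by (intro domination_exponent_le kernel.bip_ge_more_unbalanced) auto
      then show ?thesis
        by (rule order_trans) (intro ennreal_leI max.cobounded2)
    qed
  qed
  show "?\<rho> = ennreal (real (b1 + b2) / real (a1 + a2))"
    if "a1 \<le> b1" "b2 \<le> a2" "b1 + b2 \<le> a1 + a2"
  proof -
    \<comment> \<open>In this range the mixed packing is always the right one, since
      \<open>a1 \<le> b1\<close> and \<open>b2 \<le> a2\<close> fix the comparison of the two
      products.\<close>
    have "b2 * a1 \<le> b1 * a2"
      using mult_le_mono[OF that(2,1)] by (simp add: mult.commute)
    then show ?thesis
      using that assms
      by (intro antisym domination_exponent_le clique kernel.bip_ge_more_unbalanced) auto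
  qed
  show "?\<rho> = ennreal (real b1 / (real a1 + real a2 - 1))"
    if "a1 \<le> b1" "b2 = 1" "a1 + a2 \<le> b1 + b2"
  proof (rule antisym)
    \<comment> \<open>With \<open>b2 = 1\<close> the star has \<open>b1\<close> edges, which is its
      number of vertices minus one; both subtractions on naturals are exact.\<close>
    have "real (b1 + b2 - 1) / real (a1 + a2 - 1) = real b1 / (real a1 + real a2 - 1)"
      using that pos by (simp add: of_nat_diff)
    then show "ennreal (real b1 / (real a1 + real a2 - 1)) \<le> ?\<rho>"
      using two_cliques by simp
    show "?\<rho> \<le> ennreal (real b1 / (real a1 + real a2 - 1))"
      unfolding \<open>b2 = 1\<close> using that pos
      by (intro domination_exponent_le kernel.bip_ge_star) auto
  qed
qed

end
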